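(* Given a POMDP $G=(S,A,\delta,\mathcal{O},\gamma,s_0)$ and a Muller objective $\mathsf{Muller}(\mathcal{F})$ with the set $D$ of colors, the following assertions hold: (1) If there is a finite-memory almost-sure winning strategy $\sigma$, then the projected strategy $\mathit{proj}(\sigma)$, with memory of size at most $\mathsf{Mem}^*=2^{2\cdot|S|}\cdot|\mathfrak{D}|^{|S|}$ (where $\mathfrak{D}=\mathcal{P}(\mathcal{P}(D))$), is also an almost-sure winning strategy. (2) If there is a finite-memory positive winning strategy $\sigma$, then the projected strategy $\mathit{proj}(\sigma)$, with memory of size at most $\mathsf{Mem}^*$, is also a positive winning strategy. (3) Finite-memory almost-sure (resp. positive) winning strategies require at least exponential memory in general, and randomized belief-based stationary strategies are not sufficient in general for finite-memory almost-sure and positive winning strategies.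
   Context: For a finite set $X$, $\mathcal{P}(X)$ is its power set, $\mathcal{D}(X)$ the set of probability distributions on $X$, and $\mathrm{Supp}(f)$ the support of $f\in\mathcal{D}(X)$. A POMDP is a tuple $G=(S,A,\delta,\mathcal{O},\gamma,s_0)$ with a finite set $S$ of states, a finite set $A$ of actions, a transition function $\delta:S\times A\to\mathcal{D}(S)$, a finite set $\mathcal{O}$ of observations, an observation function $\gamma:S\to\mathcal{O}$, and an initial state $s_0\in S$; it is assumed throughout that $|\gamma^{-1}(\gamma(s_0))|=1$. A play is an infinite sequence $(s_0,a_0,s_1,a_1,\dots)$ with $\delta(s_i,a_i)(s_{i+1})>0$ for all $i$. A finite-memory strategy is $\sigma=(\sigma_u,\sigma_n,M,m_0)$ with $M$ a finite memory set, $m_0\in M$ the initial memory, $\sigma_n:M\to\mathcal{D}(A)$ the action selection function and $\sigma_u:M\times\mathcal{O}\times A\to\mathcal{D}(M)$ the memory update function; its memory size is $|M|$. It induces the finite Markov chain $G\restriction\sigma$ on $S\times M$ with $\delta_\sigma((s',m')\mid(s,m))=\sum_{a\in A}\sigma_n(m)(a)\cdot\delta(s,a)(s')\cdot\sigma_u(m,\gamma(s'),a)(m')$. $\mathbb{P}^\sigma$ is the probability measure on plays obtained by playing $\sigma$ from $s_0$ with initial memory $m_0$: in memory $m$ and state $s$, an action $a$ is sampled from $\sigma_n(m)$, the next state $s'$ from $\delta(s,a)$, and the next memory from $\sigma_u(m,\gamma(s'),a)$. With a color mapping $\mathsf{col}:S\to D$ and $\mathcal{F}\in\mathcal{P}(\mathcal{P}(D))$,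 $\mathsf{Muller}(\mathcal{F})$ is the set of plays $\rho$ with $\{\mathsf{col}(s)\mid s\in\mathrm{Inf}(\rho)\}\in\mathcal{F}$, where $\mathrm{Inf}(\rho)$ is the set of states occurring infinitely often in $\rho$; for $U\subseteq S$, $\mathsf{col}(U)=\{\mathsf{col}(s)\mid s\in U\}$. A strategy $\sigma$ is almost-sure (resp. positive) winning for an objective $\varphi$ if $\mathbb{P}^\sigma(\varphi)=1$ (resp. $>0$). The belief after a finite sequence of observations and actions is the set of states in which a prefix of a play with that observation-action sequence can end. A strategy is belief-based stationary if it plays only depending on the current belief; it is randomized if it may choose distributions over actions. Recurrence functions. A recurrent class of a finite Markov chain is a bottom strongly connected component of its transition graph; $\mathsf{Rec}(G\restriction\sigma)((s,m))$ is the set of recurrent classes of $G\restriction\sigma$ reachable from $(s,m)$. $\mathsf{Proj}_1$ is the projection of subsets of $S\times M$ to $S$. For $m\in M$, $\mathsf{SetRec}_\sigma(m)\in\mathfrak{D}^{|S|}$ (viewed as a function $S\to\mathfrak{D}$) is given by $\mathsf{SetRec}_\sigma(m)(s)=\{\mathsf{col}(\mathsf{Proj}_1(U))\mid U\in\mathsf{Rec}(G\restriction\sigma)((s,m))\}$, and $\mathsf{BoolRec}_\sigma(m)\in\{0,1\}^{|S|}$ (viewed as a function $S\to\{0,1\}$) by $\mathsf{BoolRec}_\sigma(m)(s)=1$ if $(s,m)$ belongs to a recurrent class of $G\restriction\sigma$, and $0$ if not. Projection graph $(V,E)$ of $\sigma$: $V=\{(U,\mathsf{BoolRec}_\sigma(m),\mathsf{SetRec}_\sigma(m))\mid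 U\subseteq S,\ m\in M\}$. For $U\subseteq S$, $m\in M$ and $a\in\mathrm{Supp}(\sigma_n(m))$, let $\overline{U}=\bigcup_{s\in U}\mathrm{Supp}(\delta(s,a))$; for every $(U',m')$ such that there exists $o\in\mathcal{O}$ with $\gamma^{-1}(o)\cap\overline{U}=U'$ and $m'\in\mathrm{Supp}(\sigma_u(m,o,a))$, the edge $(U,\mathsf{BoolRec}_\sigma(m),\mathsf{SetRec}_\sigma(m))\xrightarrow{a}(U',\mathsf{BoolRec}_\sigma(m'),\mathsf{SetRec}_\sigma(m'))$ is in $E$. Projected strategy $\mathit{proj}(\sigma)=(\sigma'_u,\sigma'_n,M',m'_0)$: $M'=V$; $m'_0=(\{s_0\},\mathsf{BoolRec}_\sigma(m_0),\mathsf{SetRec}_\sigma(m_0))$; for $v\in M'$, $\sigma'_n(v)$ is the uniform distribution over $\{a\in A\mid\exists v'\in M':\ v\xrightarrow{a}v'\in E\}$; for $v\in M'$, $o\in\mathcal{O}$, $a\in A$, $\sigma'_u(v,o,a)$ is the uniform distribution over $\{v'=(U',B',L')\in M'\mid v\xrightarrow{a}v'\in E\text{ and }U'\subseteq\gamma^{-1}(o)\}$.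
   Formalization: In the memory update of proj(σ), successors (U',B',L') must have U' nonempty (with empty U' allowed, updates for impossible observations can be sampled and (1) fails); where no successor exists, the memory is left unchanged. D is taken finite. *)

theory Defs
  imports "HOL-Probability.Probability"
begin

section \<open>POMDPs and plays\<close>

text \<open>The components are total on the underlying types; only their restriction to the carrier sets
  matters. A distribution on a finite set \<open>X\<close> is a \<open>pmf\<close> whose support is contained in \<open>X\<close>.\<close>

record ('s, 'a, 'o) pomdp =
  states :: "'s set"
  actions :: "'a set"
  trans :: "'s \<Rightarrow> 'a \<Rightarrow> 's pmf"
  observations :: "'o set"
  obs :: "'s \<Rightarrow> 'o"
  start :: 's

definition obs_class :: "('s, 'a, 'o) pomdp \<Rightarrow> 'o \<Rightarrow> 's set" where
  "obs_class G ob = {s \<in> states G. obs G s = ob}"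

definition is_pomdp :: "('s, 'a, 'o) pomdp \<Rightarrow> bool" where
  "is_pomdp G \<longleftrightarrow>
     finite (states G) \<and> finite (actions G) \<and> finite (observations G) \<and>
     (\<forall>s\<in>states G. \<forall>a\<in>actions G. set_pmf (trans G s a) \<subseteq> states G) \<and>
     obs G ` states G \<subseteq> observations G \<and>
     start G \<in> states G \<and>
     card (obs_class G (obs G (start G))) = 1"

text \<open>The play \<open>(s\<^sub>0, a\<^sub>0, s\<^sub>1, a\<^sub>1, \<dots>)\<close> is the sequence of pairs \<open>\<rho> i = (s\<^sub>i, a\<^sub>i)\<close>.\<close>

definition plays :: "('s, 'a, 'o) pomdp \<Rightarrow> (nat \<Rightarrow> 's \<times> 'a) set" where
  "plays G = {\<rho>. fst (\<rho> 0) = start G \<and>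
     (\<forall>i. snd (\<rho> i) \<in> actions G \<and>
          pmf (trans G (fst (\<rho> i)) (snd (\<rho> i))) (fst (\<rho> (Suc i))) > 0)}"

definition inf_states :: "(nat \<Rightarrow> 's \<times> 'a) \<Rightarrow> 's set" where
  "inf_states \<rho> = {s. \<exists>\<^sub>\<infinity>i. fst (\<rho> i) = s}"

definition is_coloring :: "('s, 'a, 'o) pomdp \<Rightarrow> 'd set \<Rightarrow> ('s \<Rightarrow> 'd) \<Rightarrow> bool" where
  "is_coloring G D col \<longleftrightarrow> finite D \<and> col ` states G \<subseteq> D"

definition muller ::
  "('s, 'a, 'o) pomdp \<Rightarrow> ('s \<Rightarrow> 'd) \<Rightarrow> 'd set set \<Rightarrow> (nat \<Rightarrow> 's \<times> 'a) set" where
  "muller G col \<F> = {\<rho> \<in> plays G. col ` inf_states \<rho> \<in> \<F>}"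


section \<open>Finite-memory strategies\<close>

record ('m, 'o, 'a) strategy =
  memory :: "'m set"
  minit :: 'm
  select :: "'m \<Rightarrow> 'a pmf"
  update :: "'m \<Rightarrow> 'o \<Rightarrow> 'a \<Rightarrow> 'm pmf"

definition finite_memory :: "('s, 'a, 'o) pomdp \<Rightarrow> ('m, 'o, 'a) strategy \<Rightarrow> bool" where
  "finite_memory G \<sigma> \<longleftrightarrow>
     finite (memory \<sigma>) \<and> minit \<sigma> \<in> memory \<sigma> \<and>
     (\<forall>m\<in>memory \<sigma>. set_pmf (select \<sigma> m) \<subseteq> actions G) \<and>
     (\<forall>m\<in>memory \<sigma>. \<forall>ob\<in>observations G. \<forall>a\<in>actions G. set_pmf (update \<sigma> m ob a) \<subseteq> memory \<sigma>)"

text \<open>A run records triples (state, memory, action), the action being the one sampled in that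
  state and memory; the next triple depends only on the current one.\<close>

definition run_init :: "('s, 'a, 'o) pomdp \<Rightarrow> ('m, 'o, 'a) strategy \<Rightarrow> ('s \<times> 'm \<times> 'a) pmf" where
  "run_init G \<sigma> = map_pmf (\<lambda>a. (start G, minit \<sigma>, a)) (select \<sigma> (minit \<sigma>))"

definition run_step ::
  "('s, 'a, 'o) pomdp \<Rightarrow> ('m, 'o, 'a) strategy \<Rightarrow> 's \<times> 'm \<times> 'a \<Rightarrow> ('s \<times> 'm \<times> 'a) pmf" where
  "run_step G \<sigma> = (\<lambda>(s, m, a).
     bind_pmf (trans G s a) (\<lambda>s'.
     bind_pmf (update \<sigma> m (obs G s') a) (\<lambda>m'.
     map_pmf (\<lambda>a'. (s', m', a')) (select \<sigma> m'))))"

definition run_kernel ::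
  "('s, 'a, 'o) pomdp \<Rightarrow> ('m, 'o, 'a) strategy \<Rightarrow> nat \<Rightarrow>
     (nat \<Rightarrow> 's \<times> 'm \<times> 'a) \<Rightarrow> ('s \<times> 'm \<times> 'a) measure" where
  "run_kernel G \<sigma> i \<omega> =
     measure_pmf (case i of 0 \<Rightarrow> run_init G \<sigma> | Suc j \<Rightarrow> run_step G \<sigma> (\<omega> j))"

text \<open>The Ionescu-Tulcea extension of \<open>run_kernel\<close>: the law of the run. Lemma
  \<open>emeasure_run_measure_cylinder\<close> below gives its value on cylinders.\<close>

definition run_measure ::
  "('s, 'a, 'o) pomdp \<Rightarrow> ('m, 'o, 'a) strategy \<Rightarrow> (nat \<Rightarrow> 's \<times> 'm \<times> 'a) measure" where
  "run_measure G \<sigma> =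
     projective_family.lim UNIV
       (Ionescu_Tulcea.CI (run_kernel G \<sigma>) (\<lambda>_. count_space UNIV)) (\<lambda>_. count_space UNIV)"

definition play_measure ::
  "('s, 'a, 'o) pomdp \<Rightarrow> ('m, 'o, 'a) strategy \<Rightarrow> (nat \<Rightarrow> 's \<times> 'a) measure" where
  "play_measure G \<sigma> =
     distr (run_measure G \<sigma>) (PiM UNIV (\<lambda>_. count_space UNIV)) (\<lambda>\<omega> i. (fst (\<omega> i), snd (snd (\<omega> i))))"

definition almost_sure_winning ::
  "('s, 'a, 'o) pomdp \<Rightarrow> ('m, 'o, 'a) strategy \<Rightarrow> (nat \<Rightarrow> 's \<times> 'a) set \<Rightarrow> bool" where
  "almost_sure_winning G \<sigma> \<phi> \<longleftrightarrow> measure (play_measure G \<sigma>) \<phi> = 1"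

definition positive_winning ::
  "('s, 'a, 'o) pomdp \<Rightarrow> ('m, 'o, 'a) strategy \<Rightarrow> (nat \<Rightarrow> 's \<times> 'a) set \<Rightarrow> bool" where
  "positive_winning G \<sigma> \<phi> \<longleftrightarrow> measure (play_measure G \<sigma>) \<phi> > 0"


section \<open>Belief-based stationary strategies\<close>

definition obs_action_seq :: "('s, 'a, 'o) pomdp \<Rightarrow> (nat \<Rightarrow> 's \<times> 'a) \<Rightarrow> nat \<Rightarrow> ('o \<times> 'a) list \<times> 'o" where
  "obs_action_seq G \<rho> k =
     (map (\<lambda>i. (obs G (fst (\<rho> i)), snd (\<rho> i))) [0..<k], obs G (fst (\<rho> k)))"

definition belief :: "('s, 'a, 'o) pomdp \<Rightarrow> ('o \<times> 'a) list \<times> 'o \<Rightarrow> 's set" where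
  "belief G h = {fst (\<rho> k) | \<rho> k. \<rho> \<in> plays G \<and> obs_action_seq G \<rho> k = h}"

definition runs :: "('s, 'a, 'o) pomdp \<Rightarrow> ('m, 'o, 'a) strategy \<Rightarrow> (nat \<Rightarrow> 's \<times> 'm \<times> 'a) set" where
  "runs G \<sigma> = {\<omega>. \<omega> 0 \<in> set_pmf (run_init G \<sigma>) \<and>
     (\<forall>i. \<omega> (Suc i) \<in> set_pmf (run_step G \<sigma> (\<omega> i)))}"

text \<open>Whatever memory is used, after every history that has positive probability the (randomized)
  choice of the next action is a function of the current belief alone.\<close>

definition belief_based_stationary :: "('s, 'a, 'o) pomdp \<Rightarrow> ('m, 'o, 'a) strategy \<Rightarrow> bool" where
  "belief_based_stationary G \<sigma> \<longleftrightarrow>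
     (\<exists>f :: 's set \<Rightarrow> 'a pmf. \<forall>\<omega>\<in>runs G \<sigma>. \<forall>k.
        select \<sigma> (fst (snd (\<omega> k))) =
        f (belief G (obs_action_seq G (\<lambda>i. (fst (\<omega> i), snd (snd (\<omega> i)))) k)))"


section \<open>The induced Markov chain and its recurrence functions\<close>

definition chain_trans ::
  "('s, 'a, 'o) pomdp \<Rightarrow> ('m, 'o, 'a) strategy \<Rightarrow> 's \<times> 'm \<Rightarrow> 's \<times> 'm \<Rightarrow> real" where
  "chain_trans G \<sigma> = (\<lambda>(s, m) (s', m').
     \<Sum>a\<in>actions G. pmf (select \<sigma> m) a * pmf (trans G s a) s' * pmf (update \<sigma> m (obs G s') a) m')"

definition chain_graph ::
  "('s, 'a, 'o) pomdp \<Rightarrow> ('m, 'o, 'a) strategy \<Rightarrow> (('s \<times> 'm) \<times> ('s \<times> 'm)) set" where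
  "chain_graph G \<sigma> =
     {(x, y). x \<in> states G \<times> memory \<sigma> \<and> y \<in> states G \<times> memory \<sigma> \<and> chain_trans G \<sigma> x y > 0}"

definition sccs :: "'v set \<Rightarrow> ('v \<times> 'v) set \<Rightarrow> 'v set set" where
  "sccs V E = V // {(x, y). x \<in> V \<and> y \<in> V \<and> (x, y) \<in> E\<^sup>* \<and> (y, x) \<in> E\<^sup>*}"

definition recurrent_classes ::
  "('s, 'a, 'o) pomdp \<Rightarrow> ('m, 'o, 'a) strategy \<Rightarrow> ('s \<times> 'm) set set" where
  "recurrent_classes G \<sigma> =
     {C \<in> sccs (states G \<times> memory \<sigma>) (chain_graph G \<sigma>). chain_graph G \<sigma> `` C \<subseteq> C}"

definition Rec ::
  "('s, 'a, 'o) pomdp \<Rightarrow> ('m, 'o, 'a) strategy \<Rightarrow> 's \<times> 'm \<Rightarrow> ('s \<times> 'm) set set" where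
  "Rec G \<sigma> x = {C \<in> recurrent_classes G \<sigma>. \<exists>y\<in>C. (x, y) \<in> (chain_graph G \<sigma>)\<^sup>*}"

definition SetRec ::
  "('s, 'a, 'o) pomdp \<Rightarrow> ('s \<Rightarrow> 'd) \<Rightarrow> ('m, 'o, 'a) strategy \<Rightarrow> 'm \<Rightarrow> 's \<Rightarrow> 'd set set" where
  "SetRec G col \<sigma> m = (\<lambda>s\<in>states G. {col ` fst ` C | C. C \<in> Rec G \<sigma> (s, m)})"

definition BoolRec ::
  "('s, 'a, 'o) pomdp \<Rightarrow> ('m, 'o, 'a) strategy \<Rightarrow> 'm \<Rightarrow> 's \<Rightarrow> nat" where
  "BoolRec G \<sigma> m = (\<lambda>s\<in>states G. if \<exists>C\<in>recurrent_classes G \<sigma>. (s, m) \<in> C then 1 else 0)"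


section \<open>The projected strategy\<close>

type_synonym ('s, 'd) proj_mem = "'s set \<times> ('s \<Rightarrow> nat) \<times> ('s \<Rightarrow> 'd set set)"

definition proj_vertex ::
  "('s, 'a, 'o) pomdp \<Rightarrow> ('s \<Rightarrow> 'd) \<Rightarrow> ('m, 'o, 'a) strategy \<Rightarrow> 's set \<Rightarrow> 'm \<Rightarrow> ('s, 'd) proj_mem" where
  "proj_vertex G col \<sigma> U m = (U, BoolRec G \<sigma> m, SetRec G col \<sigma> m)"

definition proj_vertices ::
  "('s, 'a, 'o) pomdp \<Rightarrow> ('s \<Rightarrow> 'd) \<Rightarrow> ('m, 'o, 'a) strategy \<Rightarrow> ('s, 'd) proj_mem set" where
  "proj_vertices G col \<sigma> = {proj_vertex G col \<sigma> U m | U m. U \<subseteq> states G \<and> m \<in> memory \<sigma>}"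

definition proj_edges ::
  "('s, 'a, 'o) pomdp \<Rightarrow> ('s \<Rightarrow> 'd) \<Rightarrow> ('m, 'o, 'a) strategy \<Rightarrow>
     (('s, 'd) proj_mem \<times> 'a \<times> ('s, 'd) proj_mem) set" where
  "proj_edges G col \<sigma> =
     {(proj_vertex G col \<sigma> U m, a, proj_vertex G col \<sigma> U' m') | U m a U' m'.
        U \<subseteq> states G \<and> m \<in> memory \<sigma> \<and> a \<in> set_pmf (select \<sigma> m) \<and>
        (\<exists>ob\<in>observations G.
           obs_class G ob \<inter> (\<Union>s\<in>U. set_pmf (trans G s a)) = U' \<and>
           m' \<in> set_pmf (update \<sigma> m ob a))}"

text \<open>The successor belief is required to be nonempty. An edge into the empty belief stems from an
  observation that cannot occur; as the empty set is contained in every observation class, it would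
  otherwise be a candidate successor under an observation unrelated to the memory update that
  produced it.\<close>

definition proj_succs ::
  "('s, 'a, 'o) pomdp \<Rightarrow> ('s \<Rightarrow> 'd) \<Rightarrow> ('m, 'o, 'a) strategy \<Rightarrow>
     ('s, 'd) proj_mem \<Rightarrow> 'o \<Rightarrow> 'a \<Rightarrow> ('s, 'd) proj_mem set" where
  "proj_succs G col \<sigma> v ob a =
     {v' \<in> proj_vertices G col \<sigma>. (v, a, v') \<in> proj_edges G col \<sigma> \<and>
        fst v' \<noteq> {} \<and> fst v' \<subseteq> obs_class G ob}"

text \<open>Where there is no successor (so that the uniform distribution does not exist) the memory is
  left unchanged; this concerns only triples \<open>(v, ob, a)\<close> that do not occur along any play.\<close>

definition proj_strategy ::
  "('s, 'a, 'o) pomdp \<Rightarrow> ('s \<Rightarrow> 'd) \<Rightarrow> ('m, 'o, 'a) strategy \<Rightarrow> (('s, 'd) proj_mem, 'o, 'a) strategy" where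
  "proj_strategy G col \<sigma> = \<lparr>
     memory = proj_vertices G col \<sigma>,
     minit = proj_vertex G col \<sigma> {start G} (minit \<sigma>),
     select = (\<lambda>v. pmf_of_set
       {a \<in> actions G. \<exists>v'\<in>proj_vertices G col \<sigma>. (v, a, v') \<in> proj_edges G col \<sigma>}),
     update = (\<lambda>v ob a.
       if proj_succs G col \<sigma> v ob a = {} then return_pmf v
       else pmf_of_set (proj_succs G col \<sigma> v ob a))\<rparr>"

definition mem_bound :: "('s, 'a, 'o) pomdp \<Rightarrow> 'd set \<Rightarrow> nat" where
  "mem_bound G D = 2 ^ (2 * card (states G)) * card (Pow (Pow D)) ^ card (states G)"


section \<open>Lower bounds\<close>

text \<open>Below, \<open>win\<close> is one of the winning notions above. States, actions, observations, colors and
  memory elements are natural numbers; as all these sets are finite, this loses no generality.\<close>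

type_synonym nat_winning =
  "(nat, nat, nat) pomdp \<Rightarrow> (nat, nat, nat) strategy \<Rightarrow> (nat \<Rightarrow> nat \<times> nat) set \<Rightarrow> bool"

text \<open>There is a family of POMDPs of linear size in \<open>n\<close> for which winning is possible with finite
  memory, but only with at least \<open>2\<^sup>n\<close> memory elements.\<close>

definition exponential_memory_required :: "nat_winning \<Rightarrow> bool" where
  "exponential_memory_required win \<longleftrightarrow>
     (\<exists>c::nat. \<forall>n::nat. \<exists>G (D :: nat set) col \<F>.
        is_pomdp G \<and> is_coloring G D col \<and> \<F> \<subseteq> Pow D \<and>
        card (states G) + card (actions G) + card (observations G) + card D \<le> c * Suc n \<and>
        (\<exists>\<sigma>. finite_memory G \<sigma> \<and> win G \<sigma> (muller G col \<F>)) \<and>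
        (\<forall>\<sigma>. finite_memory G \<sigma> \<and> win G \<sigma> (muller G col \<F>) \<longrightarrow> 2 ^ n \<le> card (memory \<sigma>)))"

definition belief_based_insufficient :: "nat_winning \<Rightarrow> bool" where
  "belief_based_insufficient win \<longleftrightarrow>
     (\<exists>G (D :: nat set) col \<F>.
        is_pomdp G \<and> is_coloring G D col \<and> \<F> \<subseteq> Pow D \<and>
        (\<exists>\<sigma>. finite_memory G \<sigma> \<and> win G \<sigma> (muller G col \<F>)) \<and>
        \<not> (\<exists>\<sigma>. finite_memory G \<sigma> \<and> belief_based_stationary G \<sigma> \<and> win G \<sigma> (muller G col \<F>)))"


section \<open>Basic facts about the measure\<close>

lemma Ionescu_Tulcea_run_kernel:
  fixes G :: "('s, 'a, 'o) pomdp" and \<sigma> :: "('m, 'o, 'a) strategy"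
  shows "Ionescu_Tulcea (run_kernel G \<sigma>) (\<lambda>_. count_space UNIV)"
proof (rule Ionescu_Tulcea.intro)
  fix i
  let ?M = "\<lambda>_::nat. count_space (UNIV :: ('s \<times> 'm \<times> 'a) set)"
  show "run_kernel G \<sigma> i \<in> measurable (PiM {0..<i} ?M) (subprob_algebra (count_space UNIV))"
  proof (cases i)
    case 0
    then show ?thesis
      by (simp add: run_kernel_def[abs_def] space_subprob_algebra measure_pmf.subprob_space_axioms)
  next
    case (Suc j)
    have "(\<lambda>\<omega>. \<omega> j) \<in> measurable (PiM {0..<i} ?M) (count_space UNIV)"
      using Suc by (intro measurable_component_singleton) auto
    moreover have "(\<lambda>x. measure_pmf (run_step G \<sigma> x))
        \<in> measurable (count_space UNIV) (subprob_algebra (count_space UNIV))"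
      by (simp add: space_subprob_algebra measure_pmf.subprob_space_axioms)
    ultimately show ?thesis
      unfolding run_kernel_def[abs_def] Suc nat.case by (rule measurable_compose)
  qed
next
  fix i \<omega>
  show "prob_space (run_kernel G \<sigma> i \<omega>)"
    by (simp add: run_kernel_def measure_pmf.prob_space_axioms)
qed

lemma sets_run_measure [measurable_cong]:
  "sets (run_measure G \<sigma>) = sets (PiM UNIV (\<lambda>_. count_space UNIV))"
proof -
  interpret Ionescu_Tulcea "run_kernel G \<sigma>" "\<lambda>_. count_space UNIV"
    by (rule Ionescu_Tulcea_run_kernel)
  show ?thesis unfolding run_measure_def by (rule PF.sets_lim)
qed

lemma emeasure_run_measure_cylinder:
  fixes G :: "('s, 'a, 'o) pomdp" and \<sigma> :: "('m, 'o, 'a) strategy"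
  shows "emeasure (run_measure G \<sigma>) {\<omega>. \<forall>i\<le>n. \<omega> i = x i} =
     ennreal (pmf (run_init G \<sigma>) (x 0) * (\<Prod>i<n. pmf (run_step G \<sigma> (x i)) (x (Suc i))))"
proof -
  let ?M = "\<lambda>_::nat. count_space (UNIV :: ('s \<times> 'm \<times> 'a) set)"
  interpret Ionescu_Tulcea "run_kernel G \<sigma>" ?M
    by (rule Ionescu_Tulcea_run_kernel)
  let ?X = "\<lambda>n. PiE {0..<n} (\<lambda>i. {x i})"
  have X: "?X n \<in> sets (PiM {0..<n} ?M)" for n
    by (rule sets_PiM_I_finite) auto
  have X_iff: "y \<in> ?X n \<longleftrightarrow> y = restrict x {0..<n}" for y n
    by (auto simp: PiE_iff extensional_def restrict_def fun_eq_iff)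
  have C: "emeasure (C 0 n (\<lambda>_. undefined)) (?X n) = (\<Prod>i<n. emeasure (run_kernel G \<sigma> i x) {x i})" for n
  proof (induction n)
    case 0
    show ?case by (simp add: PiM_empty)
  next
    case (Suc n)
    let ?u = "\<lambda>_::nat. undefined :: 's \<times> 'm \<times> 'a"
    have u: "?u \<in> space (PiM {0..<0} ?M)" by (simp add: space_PiM)
    have eP: "emeasure (eP n y) (?X (Suc n))
        = emeasure (run_kernel G \<sigma> n x) {x n} * indicator (?X n) y"
      if y: "y \<in> space (C 0 n ?u)" for y
    proof -
      have y': "y \<in> space (PiM {0..<n} ?M)" using y space_C[OF u, of n] by simp
      then have ext: "y \<in> extensional {0..<n}" by (auto simp: space_PiM PiE_iff)
      have vim: "(\<lambda>z. y(n := z)) -` ?X (Suc n) = (if y \<in> ?X n then {x n} else {})"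
        using ext by (auto simp del: split_paired_All simp add: PiE_iff extensional_def atLeastLessThanSuc split: if_splits)
      have "run_kernel G \<sigma> n y = run_kernel G \<sigma> n x" if "y \<in> ?X n"
        using that by (auto simp: run_kernel_def PiE_iff split: nat.split)
      with vim show ?thesis
        by (subst emeasure_eP[OF y' X]) auto
    qed
    have "emeasure (C 0 (Suc n) ?u) (?X (Suc n)) = (\<integral>\<^sup>+y. emeasure (eP n y) (?X (Suc n)) \<partial>C 0 n ?u)"
      using prob_space.not_empty[OF prob_space_C[OF u, of n]] X[of "Suc n"] measurable_eP[of n]
      by (simp add: emeasure_bind[where N = "PiM {0..<Suc n} ?M"]
          measurable_cong_sets[OF sets_C[OF u, of n] refl])
    also have "\<dots> = (\<integral>\<^sup>+y. emeasure (run_kernel G \<sigma> n x) {x n} * indicator (?X n) y \<partial>C 0 n ?u)"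
      by (intro nn_integral_cong eP)
    also have "\<dots> = emeasure (run_kernel G \<sigma> n x) {x n} * emeasure (C 0 n ?u) (?X n)"
      using X[of n] sets_C[OF u, of n] by (intro nn_integral_cmult_indicator) simp
    finally show ?case
      using Suc.IH by (simp add: mult.commute)
  qed
  have emb: "{\<omega>. \<forall>i\<le>n. \<omega> i = x i} = PF.emb UNIV {0..<Suc n} (?X (Suc n))"
    by (auto simp: prod_emb_def PiE_iff)
  have "emeasure (run_measure G \<sigma>) {\<omega>. \<forall>i\<le>n. \<omega> i = x i} = emeasure (CI {0..<Suc n}) (?X (Suc n))"
    unfolding run_measure_def emb by (rule lim) (use X in auto)
  also have "\<dots> = emeasure (C 0 (Suc n) (\<lambda>_. undefined)) (?X (Suc n))"
    using X[of "Suc n"] emeasure_CI[of "{0..<Suc n}" "Suc n"] 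
    by (simp add: prod_emb_id PiE_iff sets.sets_into_space)
  also have "\<dots> = (\<Prod>i<Suc n. emeasure (run_kernel G \<sigma> i x) {x i})"
    by (rule C)
  also have "\<dots> = ennreal (pmf (run_init G \<sigma>) (x 0) * (\<Prod>i<n. pmf (run_step G \<sigma> (x i)) (x (Suc i))))"
    unfolding prod.lessThan_Suc_shift
    by (simp add: run_kernel_def emeasure_pmf_single ennreal_mult' prod_ennreal[symmetric] prod_nonneg)
  finally show ?thesis .
qed

lemma prob_space_run_measure: "prob_space (run_measure G \<sigma>)"
proof -
  interpret Ionescu_Tulcea "run_kernel G \<sigma>" "\<lambda>_. count_space UNIV"
    by (rule Ionescu_Tulcea_run_kernel)
  have "emeasure PF.lim (PF.emb UNIV {} (space (PiM {} (\<lambda>_. count_space UNIV)))) = 1"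
    using PF.prob_space_P[of "{}"] prob_space.emeasure_space_1
    by (subst lim) (fastforce simp: CI_def)+
  then show ?thesis
    unfolding run_measure_def
    by (intro prob_spaceI) (simp add: prod_emb_def space_PiM vimage_def restrict_def)
qed

lemma sets_play_measure [measurable_cong]:
  "sets (play_measure G \<sigma>) = sets (PiM UNIV (\<lambda>_. count_space UNIV))"
  by (simp add: play_measure_def)

lemma measurable_play_of_run:
  "(\<lambda>\<omega> i. (fst (\<omega> i), snd (snd (\<omega> i)))) \<in>
     measurable (run_measure G \<sigma>) (PiM UNIV (\<lambda>_. count_space UNIV))"
proof (rule measurable_PiM_single')
  fix i :: nat
  have "(\<lambda>\<omega>. \<omega> i) \<in> measurable (run_measure G \<sigma>) (count_space UNIV)"
    unfolding measurable_cong_sets[OF sets_run_measure refl]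
    by (rule measurable_component_singleton) simp
  then show "(\<lambda>\<omega>. (fst (\<omega> i), snd (snd (\<omega> i)))) \<in> measurable (run_measure G \<sigma>) (count_space UNIV)"
    by (rule measurable_compose[where g = "\<lambda>x. (fst x, snd (snd x))"]) simp
qed (auto simp: space_PiM)

lemma prob_space_play_measure: "prob_space (play_measure G \<sigma>)"
  unfolding play_measure_def
  by (intro prob_space.prob_space_distr prob_space_run_measure measurable_play_of_run)

lemma muller_in_sets:
  fixes G :: "('s, 'a, 'o) pomdp"
  assumes "is_pomdp G"
  shows "muller G col \<F> \<in> sets (play_measure G \<sigma>)"
proof -
  let ?P = "PiM UNIV (\<lambda>_::nat. count_space (UNIV :: ('s \<times> 'a) set))"
  let ?SA = "states G \<times> actions G"
  have fin: "finite (states G)" "finite ?SA" using assms by (auto simp: is_pomdp_def)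
  have [measurable]: "(\<lambda>\<rho>. \<rho> i) \<in> measurable ?P (count_space UNIV)" for i
    by (rule measurable_component_singleton) simp
  have coord: "{\<rho>. Q (\<rho> i)} \<in> sets ?P" for Q i
  proof -
    have "(\<lambda>\<rho>. \<rho> i) -` Collect Q \<inter> space ?P \<in> sets ?P"
      by (rule measurable_sets) measurable
    then show ?thesis by (simp add: space_PiM vimage_def)
  qed
  define R where "R = {(x, y). x \<in> ?SA \<and> y \<in> ?SA \<and> pmf (trans G (fst x) (snd x)) (fst y) > 0}"
  have "finite R" using fin by (intro finite_subset[of R "?SA \<times> ?SA"]) (auto simp: R_def)
  have in_SA: "\<rho> i \<in> ?SA" if "\<rho> \<in> plays G" for \<rho> i
  proof (induction i)
    case 0
    then show ?case using that assms by (auto simp: plays_def is_pomdp_def mem_Times_iff)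
  next
    case (Suc i)
    have "fst (\<rho> (Suc i)) \<in> set_pmf (trans G (fst (\<rho> i)) (snd (\<rho> i)))"
      using that by (simp add: plays_def set_pmf_iff less_imp_neq[symmetric])
    then show ?case
      using that Suc assms by (auto simp: plays_def is_pomdp_def mem_Times_iff)
  qed
  have "plays G = {\<rho>. fst (\<rho> 0) = start G} \<inter>
      (\<Inter>i. \<Union>r\<in>R. {\<rho>. \<rho> i = fst r} \<inter> {\<rho>. \<rho> (Suc i) = snd r})"
    (is "_ = ?A")
  proof
    show "plays G \<subseteq> ?A"
    proof
      fix \<rho> assume \<rho>: "\<rho> \<in> plays G"
      have "(\<rho> i, \<rho> (Suc i)) \<in> R" for i
        using \<rho> in_SA[OF \<rho>] by (auto simp: plays_def R_def)
      then show "\<rho> \<in> ?A" using \<rho> by (force simp: plays_def)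
    qed
    show "?A \<subseteq> plays G"
    proof
      fix \<rho> assume \<rho>: "\<rho> \<in> ?A"
      then have "(\<rho> i, \<rho> (Suc i)) \<in> R" for i
      proof -
        from \<rho> obtain r where "r \<in> R" "\<rho> i = fst r" "\<rho> (Suc i) = snd r" by blast
        then show ?thesis by simp
      qed
      with \<rho> show "\<rho> \<in> plays G" by (auto simp: plays_def R_def mem_Times_iff)
    qed
  qed
  moreover have "?A \<in> sets ?P"
  proof (rule sets.Int)
    show "{\<rho>. fst (\<rho> 0) = start G} \<in> sets ?P"
      by (rule coord)
    have "(\<Union>r\<in>R. {\<rho>. \<rho> i = fst r} \<inter> {\<rho>. \<rho> (Suc i) = snd r}) \<in> sets ?P" for i
      using \<open>finite R\<close> coord[of "\<lambda>x. x = z" for z] by (intro sets.finite_UN sets.Int) auto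
    then show "(\<Inter>i. \<Union>r\<in>R. {\<rho>. \<rho> i = fst r} \<inter> {\<rho>. \<rho> (Suc i) = snd r}) \<in> sets ?P"
      by (intro sets.countable_INT) auto
  qed
  ultimately have plays: "plays G \<in> sets ?P" by simp
  have Inf: "{\<rho>. (s \<in> inf_states \<rho>) = b} \<in> sets ?P" for s b
  proof -
    let ?I = "\<Inter>m. \<Union>n\<in>{m<..}. {\<rho>. fst (\<rho> n) = s}"
    have "?I \<in> sets ?P"
      by (intro sets.countable_INT sets.countable_UN' image_subsetI coord[of "\<lambda>x. fst x = s"]) auto
    moreover have "{\<rho>. (s \<in> inf_states \<rho>) = b} = (if b then ?I else space ?P - ?I)"
      by (auto simp: inf_states_def INFM_nat space_PiM)
    ultimately show ?thesis by simp
  qed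
  have inf_sub: "inf_states \<rho> \<subseteq> states G" if "\<rho> \<in> plays G" for \<rho>
  proof
    fix s assume "s \<in> inf_states \<rho>"
    then obtain i where "fst (\<rho> i) = s"
      by (auto simp: inf_states_def dest: INFM_EX)
    then show "s \<in> states G" using in_SA[OF that, of i] by auto
  qed
  have "muller G col \<F> = plays G \<inter> (\<Union>T\<in>{T \<in> Pow (states G). col ` T \<in> \<F>}.
      plays G \<inter> (\<Inter>s\<in>states G. {\<rho>. (s \<in> inf_states \<rho>) = (s \<in> T)}))" (is "_ = ?B")
  proof
    show "muller G col \<F> \<subseteq> ?B"
      using inf_sub by (auto simp: muller_def)
    show "?B \<subseteq> muller G col \<F>"
    proof
      fix \<rho> assume "\<rho> \<in> ?B"
      then obtain T where T: "\<rho> \<in> plays G" "T \<subseteq> states G" "col ` T \<in> \<F>"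
        "\<forall>s\<in>states G. (s \<in> inf_states \<rho>) = (s \<in> T)" by auto
      then have "inf_states \<rho> = T" using inf_sub by blast
      with T show "\<rho> \<in> muller G col \<F>" by (simp add: muller_def)
    qed
  qed
  moreover have "?B \<in> sets ?P"
  proof (intro sets.Int plays sets.finite_UN)
    show "finite {T \<in> Pow (states G). col ` T \<in> \<F>}" using fin by simp
    have "states G \<noteq> {}" using assms by (auto simp: is_pomdp_def)
    then show "(\<Inter>s\<in>states G. {\<rho>. (s \<in> inf_states \<rho>) = (s \<in> T)}) \<in> sets ?P" for T
      using fin Inf by (intro sets.finite_INT) auto
  qed
  ultimately show ?thesis by (simp add: sets_play_measure)
qed

end

theory Submission
  imports Defs
begin

text \<open>Almost surely the configurations (state, memory) that a run visits infinitely often form a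
  recurrent class, so both winning notions depend only on the color sets of the recurrent classes
  reachable from the start. Every path of the chain of \<open>\<sigma>\<close> lifts to the chain of the projected strategy,
  and every edge of the latter projects to an edge between two configurations with the recorded
  recurrence information. Along projected edges the recorded color sets can only shrink, and they are
  frozen once the recorded bit is \<open>1\<close>, which remains reachable throughout. Hence the color sets of the
  reachable recurrent classes are the same for both strategies.\<close>

section \<open>Finite Markov chains\<close>

text \<open>The obstacle is that the projection forgets the memory. A vertex fixes the belief and
  the recurrence information, but several memories can give the same vertex, and consecutive edges
  may be realised by different ones. So a path of the projected chain need not project to a path of
  the original chain, whereas lifting keeps the memory and composes. What is proved about the
  projected chain is therefore either a property of a single edge that depends on vertices alone, or
  the existence of a path obtained by lifting. The belief has a job of its own: being nonempty and
  inside one observation class, it reveals under which observation the memory was updated. For the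
  lower bounds, each example is won almost surely with finite memory, while the restricted
  strategies fail even to win positively, so one example serves both notions. Both objectives are
  \<open>{{0}}\<close>: the single bad state, of color 1, occurs only finitely often. A winning
  strategy then has a reachable recurrent class without the bad state, and the arguments take place
  inside that class.\<close>

locale finite_chain = prob_space M
  for M :: "(nat \<Rightarrow> 'x) measure" +
  fixes I :: "'x pmf" and K :: "'x \<Rightarrow> 'x pmf" and X :: "'x set"
  assumes sets_M: "sets M = sets (PiM UNIV (\<lambda>_. count_space UNIV))"
    and emeasure_cylinder: "\<And>n x. emeasure M {\<omega>. \<forall>i\<le>n. \<omega> i = x i} =
      ennreal (pmf I (x 0) * (\<Prod>i<n. pmf (K (x i)) (x (Suc i))))"
    and finite_X: "finite X"
    and set_pmf_I: "set_pmf I \<subseteq> X"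
    and set_pmf_K: "\<And>x. x \<in> X \<Longrightarrow> set_pmf (K x) \<subseteq> X"
begin

definition cyl :: "nat \<Rightarrow> (nat \<Rightarrow> 'x) \<Rightarrow> (nat \<Rightarrow> 'x) set" where
  "cyl n p = {\<omega>. \<forall>i\<le>n. \<omega> i = p i}"

text \<open>The last conjunct separates random trajectories from arbitrary paths: the set of states
  visited infinitely often is closed under successors.\<close>

definition typical :: "(nat \<Rightarrow> 'x) \<Rightarrow> bool" where
  "typical \<omega> \<longleftrightarrow> \<omega> 0 \<in> set_pmf I \<and> (\<forall>i. \<omega> (Suc i) \<in> set_pmf (K (\<omega> i))) \<and>
     (\<forall>x y. (\<exists>\<^sub>\<infinity>i. \<omega> i = x) \<and> y \<in> set_pmf (K x) \<longrightarrow> (\<exists>\<^sub>\<infinity>i. \<omega> i = y))"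

section \<open>Cylinders and trajectories that follow the chain\<close>

lemma space_M: "space M = UNIV"
  using sets_eq_imp_space_eq[OF sets_M] by (simp add: space_PiM)

lemma coord_sets: "{\<omega>. Q (\<omega> i)} \<in> sets M"
proof -
  let ?P = "PiM UNIV (\<lambda>_::nat. count_space (UNIV :: 'x set))"
  have "(\<lambda>\<omega>. \<omega> i) \<in> measurable ?P (count_space UNIV)"
    by (rule measurable_component_singleton) simp
  then have "(\<lambda>\<omega>. \<omega> i) -` Collect Q \<inter> space ?P \<in> sets ?P"
    by (rule measurable_sets) simp
  then show ?thesis by (simp add: sets_M space_PiM vimage_def)
qed

lemma pred_coord [measurable]: "Measurable.pred M (\<lambda>\<omega>. Q (\<omega> i))"
  unfolding pred_def using coord_sets[of Q i] by (simp add: space_M)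

lemma cyl_sets [measurable]: "cyl n p \<in> sets M"
proof -
  have "{\<omega> \<in> space M. \<forall>i\<le>n. \<omega> i = p i} \<in> sets M"
    by measurable
  then show ?thesis by (simp add: cyl_def space_M)
qed

lemma prob_cyl: "prob (cyl n p) = pmf I (p 0) * (\<Prod>i<n. pmf (K (p i)) (p (Suc i)))"
  unfolding measure_def cyl_def emeasure_cylinder by (simp add: prod_nonneg)

lemma prob_cyl_Suc:
  "prob (cyl (Suc n) (p(Suc n := z))) = prob (cyl n p) * pmf (K (p n)) z"
proof -
  have "(\<Prod>i<n. pmf (K ((p(Suc n := z)) i)) ((p(Suc n := z)) (Suc i))) = (\<Prod>i<n. pmf (K (p i)) (p (Suc i)))"
    by (rule prod.cong) auto
  then show ?thesis by (simp add: prob_cyl)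
qed

lemma AE_start: "AE \<omega> in M. \<omega> 0 \<in> set_pmf I"
proof -
  have fin: "finite (set_pmf I)" using finite_X set_pmf_I finite_subset by blast
  have eq: "{\<omega>. \<omega> 0 \<in> set_pmf I} = (\<Union>z\<in>set_pmf I. cyl 0 (\<lambda>_. z))"
    by (auto simp: cyl_def)
  have "prob (\<Union>z\<in>set_pmf I. cyl 0 (\<lambda>_. z)) = (\<Sum>z\<in>set_pmf I. prob (cyl 0 (\<lambda>_. z)))"
    by (intro finite_measure_finite_Union fin) (auto intro: cyl_sets simp: disjoint_family_on_def, auto simp: cyl_def)
  also have "\<dots> = 1" using fin by (simp add: prob_cyl sum_pmf_eq_1)
  finally have "prob {\<omega>. \<omega> 0 \<in> set_pmf I} = 1" by (simp only: eq)
  from AE_prob_1[OF this] show ?thesis by simp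
qed

text \<open>The extensions of the cylinder by supported successors are disjoint, and as
  \<open>K (p n)\<close> sums to 1 over its support they carry all of its mass.\<close>

lemma AE_next_cyl:
  assumes "p n \<in> X"
  shows "AE \<omega> in M. \<omega> \<in> cyl n p \<longrightarrow> \<omega> (Suc n) \<in> set_pmf (K (p n))"
proof -
  let ?S = "set_pmf (K (p n))"
  have fin: "finite ?S" using finite_X set_pmf_K[OF assms] finite_subset by blast
  let ?A = "\<Union>z\<in>?S. cyl (Suc n) (p(Suc n := z))"
  have A: "?A \<in> sets M" using fin by (intro sets.finite_UN cyl_sets)
  have "prob ?A = (\<Sum>z\<in>?S. prob (cyl (Suc n) (p(Suc n := z))))"
  proof (intro finite_measure_finite_Union fin)
    show "disjoint_family_on (\<lambda>z. cyl (Suc n) (p(Suc n := z))) ?S"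
      by (auto simp: disjoint_family_on_def cyl_def)
  qed auto
  also have "\<dots> = prob (cyl n p)"
    using fin by (simp add: prob_cyl_Suc sum_distrib_left[symmetric] sum_pmf_eq_1 del: fun_upd_apply)
  finally have "prob ?A = prob (cyl n p)" .
  moreover have sub: "?A \<subseteq> cyl n p" by (auto simp: cyl_def split: if_splits)
  ultimately have "prob (cyl n p - ?A) = 0"
    using A by (subst finite_measure_Diff) auto
  then have "cyl n p - ?A \<in> null_sets M"
    using A by (auto simp: emeasure_eq_measure null_sets_def intro: sets.Diff)
  moreover have "\<omega> \<in> cyl n p \<Longrightarrow> \<omega> (Suc n) \<notin> ?S \<Longrightarrow> \<omega> \<in> cyl n p - ?A" for \<omega>
    by (auto simp: cyl_def) 
  ultimately show ?thesis
    by (intro AE_I'[of "cyl n p - ?A"]) (auto 0 0)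
qed

lemma AE_prefix:
  "AE \<omega> in M. (\<forall>i\<le>n. \<omega> i \<in> X) \<and> \<omega> (Suc n) \<in> set_pmf (K (\<omega> n))"
proof -
  have step: "AE \<omega> in M. (\<forall>i\<le>n. \<omega> i \<in> X) \<longrightarrow> \<omega> (Suc n) \<in> set_pmf (K (\<omega> n))" for n
  proof -
    \<comment> \<open>Finitely many prefixes suffice: a trajectory inside \<open>X\<close> up to
      time \<open>n\<close> lies in the cylinder of its own restriction.\<close>
    have "AE \<omega> in M. \<forall>p\<in>PiE {..n} (\<lambda>_. X). \<omega> \<in> cyl n p \<longrightarrow> \<omega> (Suc n) \<in> set_pmf (K (p n))"
      using finite_X by (intro AE_finite_allI finite_PiE AE_next_cyl) auto
    then show ?thesis
    proof eventually_elim
      case (elim \<omega>)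
      show ?case
      proof
        assume "\<forall>i\<le>n. \<omega> i \<in> X"
        then have "restrict \<omega> {..n} \<in> PiE {..n} (\<lambda>_. X)" by auto
        moreover have "\<omega> \<in> cyl n (restrict \<omega> {..n})" by (simp add: cyl_def)
        ultimately have "\<omega> (Suc n) \<in> set_pmf (K (restrict \<omega> {..n} n))" using elim by blast
        then show "\<omega> (Suc n) \<in> set_pmf (K (\<omega> n))" by simp
      qed
    qed
  qed
  have "AE \<omega> in M. \<forall>i\<le>n. \<omega> i \<in> X"
  proof (induction n)
    case 0
    then show ?case using AE_start set_pmf_I by auto
  next
    case (Suc n)
    then show ?case using step[of n]
    proof eventually_elim
      case (elim \<omega>)
      then show ?case using set_pmf_K[of "\<omega> n"] by (auto simp: le_Suc_eq)
    qed
  qed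
  then show ?thesis using step[of n] by eventually_elim auto
qed

lemma AE_run:
  "AE \<omega> in M. \<omega> 0 \<in> set_pmf I \<and> (\<forall>i. \<omega> i \<in> X \<and> \<omega> (Suc i) \<in> set_pmf (K (\<omega> i)))"
proof -
  have "AE \<omega> in M. \<forall>n. (\<forall>i\<le>n. \<omega> i \<in> X) \<and> \<omega> (Suc n) \<in> set_pmf (K (\<omega> n))"
    using AE_prefix by (simp add: AE_all_countable)
  then show ?thesis using AE_start by eventually_elim auto
qed

text \<open>The two windows are offset by one, so that every counted visit to \<open>x\<close> is
  followed by a moment at which \<open>y\<close> is forbidden.\<close>

definition avoid :: "'x \<Rightarrow> 'x \<Rightarrow> nat \<Rightarrow> nat \<Rightarrow> nat \<Rightarrow> (nat \<Rightarrow> 'x) set" where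
  "avoid x y l n k = {\<omega>. k \<le> card {i\<in>{l..<l+n}. \<omega> i = x} \<and> (\<forall>i\<in>{l<..l+n}. \<omega> i \<noteq> y)}"

text \<open>The number of visits is not a condition on single coordinates, so the event is split by
  the exact set \<open>A\<close> of visiting times, of which there are finitely many.\<close>

lemma avoid_sets [measurable]: "avoid x y l n k \<in> sets M"
proof -
  have "avoid x y l n k = (\<Union>A\<in>{A. A \<subseteq> {l..<l+n} \<and> k \<le> card A}.
      {\<omega>\<in>space M. (\<forall>i\<in>{l..<l+n}. (\<omega> i = x) = (i \<in> A)) \<and> (\<forall>i\<in>{l<..l+n}. \<omega> i \<noteq> y)})"
    (is "_ = ?B")
  proof
    show "avoid x y l n k \<subseteq> ?B"
    proof
      fix \<omega> assume "\<omega> \<in> avoid x y l n k"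
      then show "\<omega> \<in> ?B"
        by (intro UN_I[of "{i\<in>{l..<l+n}. \<omega> i = x}"]) (auto simp: avoid_def space_M)
    qed
    show "?B \<subseteq> avoid x y l n k"
    proof
      fix \<omega> assume "\<omega> \<in> ?B"
      then obtain A where A: "A \<subseteq> {l..<l+n}" "k \<le> card A"
        "\<forall>i\<in>{l..<l+n}. (\<omega> i = x) = (i \<in> A)" "\<forall>i\<in>{l<..l+n}. \<omega> i \<noteq> y" by auto
      then have "{i\<in>{l..<l+n}. \<omega> i = x} = A" by auto
      with A show "\<omega> \<in> avoid x y l n k" by (simp add: avoid_def)
    qed
  qed
  also have "\<dots> \<in> sets M"
  proof (rule sets.finite_UN)
    show "finite {A. A \<subseteq> {l..<l+n} \<and> k \<le> card A}" by simp
  qed measurable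
  finally show ?thesis .
qed

text \<open>Peels off time \<open>l\<close>. For \<open>k = 0\<close> the truncated
  \<open>k - 1\<close> is still correct, as the count is then unconstrained.\<close>

lemma avoid_decr:
  assumes "\<omega> \<in> avoid x y l (Suc n) k"
  shows "\<omega> (Suc l) \<noteq> y" "\<omega> \<in> avoid x y (Suc l) n (if \<omega> l = x then k - 1 else k)"
proof -
  have "{i\<in>{l..<l+Suc n}. \<omega> i = x} = (if \<omega> l = x then {l} else {}) \<union> {i\<in>{Suc l..<Suc l+n}. \<omega> i = x}"
    by (auto simp: less_Suc_eq_le Suc_le_eq le_less)
  then have "card {i\<in>{l..<l+Suc n}. \<omega> i = x} =
      (if \<omega> l = x then 1 else 0) + card {i\<in>{Suc l..<Suc l+n}. \<omega> i = x}"
    by (auto simp: card_insert_if)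
  with assms show "\<omega> \<in> avoid x y (Suc l) n (if \<omega> l = x then k - 1 else k)"
    by (auto simp: avoid_def)
qed (use assms in \<open>auto simp: avoid_def\<close>)

text \<open>Each of the \<open>k\<close> visits of \<open>x\<close> costs a factor \<open>1 - pmf (K x) y\<close>, whatever happened before.\<close>

lemma prob_avoid:
  assumes "p l \<in> X" "y \<in> X"
  shows "prob (cyl l p \<inter> avoid x y l n k) \<le> (1 - pmf (K x) y) ^ k * prob (cyl l p)"
  using assms(1)
proof (induction n arbitrary: l k p)
  case 0
  show ?case
  proof (cases "k = 0")
    case True
    then show ?thesis by (auto intro: finite_measure_mono)
  next
    case False
    then have "avoid x y l 0 k = {}" by (simp add: avoid_def)
    then show ?thesis by (simp add: pmf_le_1)
  qed
next
  case (Suc n)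
  define q where "q = pmf (K x) y"
  have q: "0 \<le> q" "q \<le> 1" by (auto simp: q_def pmf_le_1)
  define k' where "k' = (if p l = x then k - 1 else k)"
  let ?p = "\<lambda>z. p(Suc l := z)"
  let ?A = "\<lambda>z. cyl (Suc l) (?p z) \<inter> avoid x y (Suc l) n k'"
  have fin: "finite (X - {y})" using finite_X by simp
  have IH: "prob (?A z) \<le> (1 - q) ^ k' * (prob (cyl l p) * pmf (K (p l)) z)" if "z \<in> X" for z
    using Suc.IH[of "?p z" "Suc l" k'] that unfolding prob_cyl_Suc[symmetric] q_def by (simp only: fun_upd_same)
  have "AE \<omega> in M. \<omega> \<in> cyl l p \<inter> avoid x y l (Suc n) k \<longrightarrow> \<omega> \<in> (\<Union>z\<in>X - {y}. ?A z)"
    using AE_run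
  proof eventually_elim
    case (elim \<omega>)
    show ?case
    proof
      assume \<omega>: "\<omega> \<in> cyl l p \<inter> avoid x y l (Suc n) k"
      then have "\<omega> l = p l" by (simp add: cyl_def)
      with avoid_decr[of \<omega> x y l n k] \<omega> have "\<omega> (Suc l) \<noteq> y" "\<omega> \<in> avoid x y (Suc l) n k'"
        by (auto simp: k'_def)
      moreover have "\<omega> \<in> cyl (Suc l) (?p (\<omega> (Suc l)))"
        using \<omega> by (auto simp: cyl_def le_Suc_eq)
      ultimately show "\<omega> \<in> (\<Union>z\<in>X - {y}. ?A z)" using elim by blast
    qed
  qed
  then have "prob (cyl l p \<inter> avoid x y l (Suc n) k) \<le> prob (\<Union>z\<in>X - {y}. ?A z)"
    using fin by (intro finite_measure_mono_AE sets.finite_UN) auto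
  also have "\<dots> \<le> (\<Sum>z\<in>X - {y}. prob (?A z))"
    using fin by (intro measure_UNION_le) auto
  also have "\<dots> \<le> (\<Sum>z\<in>X - {y}. (1 - q) ^ k' * (prob (cyl l p) * pmf (K (p l)) z))"
    by (intro sum_mono IH) auto
  also have "\<dots> = (1 - q) ^ k' * prob (cyl l p) * (\<Sum>z\<in>X - {y}. pmf (K (p l)) z)"
    by (simp add: sum_distrib_left mult_ac)
  \<comment> \<open>Excluding \<open>y\<close> removes exactly its mass. At a visit to
    \<open>x\<close> with \<open>k\<close> positive, the rest is the factor that pays for lowering
    \<open>k\<close> to \<open>k'\<close>; otherwise it is bounded by 1.\<close>
  also have "(\<Sum>z\<in>X - {y}. pmf (K (p l)) z) = 1 - pmf (K (p l)) y"
    using finite_X assms(2) sum_pmf_eq_1[OF finite_X set_pmf_K[OF Suc.prems]]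
    by (simp add: sum_diff1)
  also have "(1 - q) ^ k' * prob (cyl l p) * (1 - pmf (K (p l)) y) \<le> (1 - q) ^ k * prob (cyl l p)"
  proof (cases "p l = x \<and> k \<noteq> 0")
    case True
    then have "(1 - q) ^ k = (1 - q) ^ k' * (1 - pmf (K (p l)) y)"
      by (cases k) (auto simp: k'_def q_def)
    then show ?thesis by simp
  next
    case False
    then have "k' = k" by (auto simp: k'_def)
    have "(1 - q) ^ k * prob (cyl l p) * (1 - pmf (K (p l)) y) \<le> (1 - q) ^ k * prob (cyl l p) * 1"
      using q by (intro mult_left_mono) (auto simp: pmf_le_1)
    then show ?thesis by (simp add: \<open>k' = k\<close>)
  qed
  finally show ?case by (simp add: q_def)
qed

text \<open>Infinitely many visits to \<open>x\<close> without a later \<open>y\<close> satisfy the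
  avoidance event for every count \<open>k\<close>, in all sufficiently long windows, and its
  probability is at most \<open>(1 - ?q) ^ k\<close>.\<close>

lemma AE_cyl_recur:
  assumes "p l \<in> X" "x \<in> X" "y \<in> set_pmf (K x)"
  shows "AE \<omega> in M. \<omega> \<in> cyl l p \<longrightarrow> (\<exists>\<^sub>\<infinity>i. \<omega> i = x) \<longrightarrow> (\<exists>i>l. \<omega> i = y)"
proof -
  let ?q = "pmf (K x) y"
  have y: "y \<in> X" using assms set_pmf_K by blast
  have q: "0 < ?q" "?q \<le> 1" using assms(3) by (auto simp: pmf_le_1 pmf_positive)
  let ?A = "\<lambda>n k. cyl l p \<inter> avoid x y l n k"
  \<comment> \<open>\<open>avoid\<close> is not monotone in the window length: longer windows admit
    more visits but forbid \<open>y\<close> for longer. The limit inferior is an increasing union,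
    to which the bound passes.\<close>
  let ?B = "\<lambda>k. \<Union>n. (\<Inter>j\<in>{n..}. ?A j k)"
  have B: "prob (?B k) \<le> (1 - ?q) ^ k" for k
  proof (rule LIMSEQ_le_const2)
    show "(\<lambda>n. prob (\<Inter>j\<in>{n..}. ?A j k)) \<longlonglongrightarrow> prob (?B k)"
    proof (rule finite_Lim_measure_incseq)
      show "range (\<lambda>n. \<Inter>j\<in>{n..}. ?A j k) \<subseteq> sets M" by auto
      show "incseq (\<lambda>n. \<Inter>j\<in>{n..}. ?A j k)" by (auto simp: incseq_def)
    qed
    have "prob (\<Inter>j\<in>{n..}. ?A j k) \<le> (1 - ?q) ^ k" for n
    proof -
      have "prob (\<Inter>j\<in>{n..}. ?A j k) \<le> prob (?A n k)"
        by (intro finite_measure_mono) auto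
      also have "\<dots> \<le> (1 - ?q) ^ k * prob (cyl l p)" using assms(1) y by (rule prob_avoid)
      also have "\<dots> \<le> (1 - ?q) ^ k * 1" using q by (intro mult_left_mono) auto
      finally show ?thesis by simp
    qed
    then show "\<exists>N. \<forall>n\<ge>N. prob (\<Inter>j\<in>{n..}. ?A j k) \<le> (1 - ?q) ^ k" by blast
  qed
  have null: "(\<Inter>k. ?B k) \<in> null_sets M"
  proof -
    have "prob (\<Inter>k. ?B k) \<le> (1 - ?q) ^ k" for k
      by (rule order_trans[OF finite_measure_mono B[of k]]) auto
    moreover have "(\<lambda>k. (1 - ?q) ^ k) \<longlonglongrightarrow> 0" using q by (intro LIMSEQ_realpow_zero) auto
    ultimately have "prob (\<Inter>k. ?B k) \<le> 0"
      by (intro LIMSEQ_le_const[of "\<lambda>k. (1 - ?q) ^ k" 0]) auto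
    then have "prob (\<Inter>k. ?B k) = 0" by (simp add: measure_le_0_iff)
    then show ?thesis by (auto simp: emeasure_eq_measure null_sets_def)
  qed
  have "\<omega> \<in> (\<Inter>k. ?B k)"
    if \<omega>: "\<omega> \<in> cyl l p" "\<exists>\<^sub>\<infinity>i. \<omega> i = x" "\<not> (\<exists>i>l. \<omega> i = y)" for \<omega>
  proof
    fix k
    have "infinite {i. \<omega> i = x}" using \<omega>(2) by (simp add: INFM_iff_infinite)
    then have "infinite ({i. \<omega> i = x} - {..<l})" by simp
    then obtain F where F: "F \<subseteq> {i. \<omega> i = x} - {..<l}" "finite F" "card F = k"
      using infinite_arbitrarily_large by blast
    then obtain n where n: "F \<subseteq> {..<n}" by (meson finite_nat_iff_bounded)
    have "k \<le> card {i\<in>{l..<l+j}. \<omega> i = x}" if "j \<ge> n" for j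
      unfolding F(3)[symmetric] using F n that by (intro card_mono) (fastforce simp: subset_eq not_less)+
    then show "\<omega> \<in> ?B k" using \<omega> by (auto simp: avoid_def)
  qed
  then show ?thesis
    by (intro AE_I'[OF null]) blast
qed

text \<open>Using the previous lemma at every time \<open>l\<close> turns one later visit to
  \<open>y\<close> into infinitely many; only countably many cylinders are involved.\<close>

lemma AE_recur:
  assumes "x \<in> X" "y \<in> set_pmf (K x)"
  shows "AE \<omega> in M. (\<exists>\<^sub>\<infinity>i. \<omega> i = x) \<longrightarrow> (\<exists>\<^sub>\<infinity>i. \<omega> i = y)"
proof -
  have "AE \<omega> in M. \<forall>l. \<forall>p\<in>PiE {..l} (\<lambda>_. X).
      \<omega> \<in> cyl l p \<longrightarrow> (\<exists>\<^sub>\<infinity>i. \<omega> i = x) \<longrightarrow> (\<exists>i>l. \<omega> i = y)"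
    unfolding AE_all_countable
    using finite_X assms by (intro allI AE_finite_allI finite_PiE AE_cyl_recur) auto
  then show ?thesis using AE_run
  proof eventually_elim
    case (elim \<omega>)
    have "\<omega> \<in> cyl l (restrict \<omega> {..l})" "restrict \<omega> {..l} \<in> PiE {..l} (\<lambda>_. X)" for l
      using elim(2) by (auto simp: cyl_def)
    with elim(1) show ?case unfolding INFM_nat[where P = "\<lambda>i. \<omega> i = y"] by blast
  qed
qed

lemma AE_typical: "AE \<omega> in M. typical \<omega>"
proof -
  have "AE \<omega> in M. \<forall>x\<in>X. \<forall>y\<in>set_pmf (K x). (\<exists>\<^sub>\<infinity>i. \<omega> i = x) \<longrightarrow> (\<exists>\<^sub>\<infinity>i. \<omega> i = y)"
    using finite_X set_pmf_K AE_recur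
    by (intro AE_finite_allI) (auto intro: finite_subset)
  then show ?thesis using AE_run
  proof eventually_elim
    case (elim \<omega>)
    have "x \<in> X" if "\<exists>\<^sub>\<infinity>i. \<omega> i = x" for x
      using INFM_EX[OF that] elim(2) by auto
    then show ?case using elim unfolding typical_def by blast
  qed
qed

text \<open>A path of the chain gives a cylinder of positive probability, which meets every almost
  sure event. This yields trajectories with almost sure properties through a prescribed
  state.\<close>

lemma ex_visiting:
  assumes "r \<in> set_pmf I" "(r, x) \<in> {(x, y). y \<in> set_pmf (K x)}\<^sup>*" "AE \<omega> in M. Q \<omega>"
  shows "\<exists>\<omega> n. Q \<omega> \<and> \<omega> n = x"
proof -
  have "\<exists>n p. p 0 \<in> set_pmf I \<and> (\<forall>i<n. p (Suc i) \<in> set_pmf (K (p i))) \<and> p n = x"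
    using assms(2)
  proof (induction rule: rtrancl_induct)
    case base
    then show ?case using assms(1) by (intro exI[of _ 0] exI[of _ "\<lambda>_. r"]) auto
  next
    case (step y z)
    then obtain n p where "p 0 \<in> set_pmf I" "\<forall>i<n. p (Suc i) \<in> set_pmf (K (p i))" "p n = y"
      by blast
    then show ?case using step
      by (intro exI[of _ "Suc n"] exI[of _ "p(Suc n := z)"]) (auto simp: less_Suc_eq)
  qed
  then obtain n p where p: "p 0 \<in> set_pmf I" "\<forall>i<n. p (Suc i) \<in> set_pmf (K (p i))" "p n = x"
    by blast
  then have "prob (cyl n p) > 0"
    unfolding prob_cyl by (intro mult_pos_pos prod_pos) (auto simp: pmf_positive)
  have "\<exists>\<omega>\<in>cyl n p. Q \<omega>"
  proof (rule ccontr)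
    assume "\<not> (\<exists>\<omega>\<in>cyl n p. Q \<omega>)"
    then have "AE \<omega> in M. Q \<omega> \<longrightarrow> \<omega> \<notin> cyl n p" by (intro AE_I2) blast
    with assms(3) have "AE \<omega> in M. \<omega> \<notin> cyl n p" by (rule AE_mp)
    then have "prob (cyl n p) = 0" by (subst prob_eq_0) (rule cyl_sets)
    with \<open>prob (cyl n p) > 0\<close> show False by simp
  qed
  with p(3) show ?thesis by (auto simp: cyl_def)
qed

end

section \<open>Winning and recurrent classes\<close>

lemma mem_run_step_iff:
  "(s', m', a') \<in> set_pmf (run_step G \<sigma> (s, m, a)) \<longleftrightarrow>
     s' \<in> set_pmf (trans G s a) \<and> m' \<in> set_pmf (update \<sigma> m (obs G s') a) \<and> a' \<in> set_pmf (select \<sigma> m')"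
  by (auto simp: run_step_def)

lemma mem_run_init_iff:
  "(s, m, a) \<in> set_pmf (run_init G \<sigma>) \<longleftrightarrow> s = start G \<and> m = minit \<sigma> \<and> a \<in> set_pmf (select \<sigma> m)"
  by (auto simp: run_init_def)

lemma finite_chain_run:
  fixes G :: "('s, 'a, 'o) pomdp" and \<sigma> :: "('m, 'o, 'a) strategy"
  assumes "is_pomdp G" "finite_memory G \<sigma>"
  shows "finite_chain (run_measure G \<sigma>) (run_init G \<sigma>) (run_step G \<sigma>) (states G \<times> memory \<sigma> \<times> actions G)"
proof (intro finite_chain.intro finite_chain_axioms.intro)
  show "prob_space (run_measure G \<sigma>)" by (rule prob_space_run_measure)
  show "sets (run_measure G \<sigma>) = sets (PiM UNIV (\<lambda>_. count_space UNIV))" by (rule sets_run_measure)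
  show "finite (states G \<times> memory \<sigma> \<times> actions G)"
    using assms by (auto simp: is_pomdp_def finite_memory_def)
  show "set_pmf (run_init G \<sigma>) \<subseteq> states G \<times> memory \<sigma> \<times> actions G"
    using assms by (fastforce simp: mem_run_init_iff is_pomdp_def finite_memory_def)
  show "set_pmf (run_step G \<sigma> x) \<subseteq> states G \<times> memory \<sigma> \<times> actions G"
    if "x \<in> states G \<times> memory \<sigma> \<times> actions G" for x
  proof -
    obtain s m a where "x = (s, m, a)" by (cases x)
    with that have x: "x = (s, m, a)" "s \<in> states G" "m \<in> memory \<sigma>" "a \<in> actions G" by auto
    show ?thesis unfolding x(1)
    proof
      fix y assume y: "y \<in> set_pmf (run_step G \<sigma> (s, m, a))"
      obtain s' m' a' where y': "y = (s', m', a')" by (cases y)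
      with y have *: "s' \<in> set_pmf (trans G s a)" "m' \<in> set_pmf (update \<sigma> m (obs G s') a)"
        "a' \<in> set_pmf (select \<sigma> m')" by (auto simp: mem_run_step_iff)
      have "s' \<in> states G" using assms(1) x * by (auto simp: is_pomdp_def)
      moreover from this have "obs G s' \<in> observations G" using assms(1) by (auto simp: is_pomdp_def)
      with * x assms(2) have "m' \<in> memory \<sigma>" by (force simp: finite_memory_def)
      ultimately show "y \<in> states G \<times> memory \<sigma> \<times> actions G"
        using y' * assms(2) by (auto simp: finite_memory_def)
    qed
  qed
qed (rule emeasure_run_measure_cylinder)

section \<open>Recurrent classes as closed, mutually reachable sets\<close>

lemma chain_graph_iff:
  assumes "is_pomdp G"
  shows "((s, m), (s', m')) \<in> chain_graph G \<sigma> \<longleftrightarrow>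
    s \<in> states G \<and> m \<in> memory \<sigma> \<and> s' \<in> states G \<and> m' \<in> memory \<sigma> \<and>
    (\<exists>a\<in>actions G. a \<in> set_pmf (select \<sigma> m) \<and> s' \<in> set_pmf (trans G s a) \<and>
       m' \<in> set_pmf (update \<sigma> m (obs G s') a))"
proof -
  let ?f = "\<lambda>a. pmf (select \<sigma> m) a * pmf (trans G s a) s' * pmf (update \<sigma> m (obs G s') a) m'"
  have "finite (actions G)" using assms by (simp add: is_pomdp_def)
  then have "sum ?f (actions G) = 0 \<longleftrightarrow> (\<forall>a\<in>actions G. ?f a = 0)"
    by (intro sum_nonneg_eq_0_iff) auto
  moreover have "0 \<le> sum ?f (actions G)" by (intro sum_nonneg) auto
  ultimately have "chain_trans G \<sigma> (s, m) (s', m') > 0 \<longleftrightarrow> (\<exists>a\<in>actions G. ?f a \<noteq> 0)"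
    by (auto simp: chain_trans_def)
  then show ?thesis by (auto simp: chain_graph_def set_pmf_iff)
qed

lemma chain_graph_subset: "chain_graph G \<sigma> \<subseteq> (states G \<times> memory \<sigma>) \<times> (states G \<times> memory \<sigma>)"
  by (auto simp: chain_graph_def)

lemma closed_rtrancl:
  assumes "E `` C \<subseteq> C" "x \<in> C" "(x, y) \<in> E\<^sup>*"
  shows "y \<in> C"
  using assms(3,1,2) by induction auto

text \<open>Replaces the quotient by a description without equivalence classes: closure makes such a
  set contain everything reachable from a point of it, hence the whole component of that
  point.\<close>

lemma recurrent_classes_iff:
  "C \<in> recurrent_classes G \<sigma> \<longleftrightarrow>
     C \<noteq> {} \<and> C \<subseteq> states G \<times> memory \<sigma> \<and> chain_graph G \<sigma> `` C \<subseteq> C \<and>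
     (\<forall>x\<in>C. \<forall>y\<in>C. (x, y) \<in> (chain_graph G \<sigma>)\<^sup>*)"
  (is "_ \<longleftrightarrow> ?R")
proof
  let ?V = "states G \<times> memory \<sigma>" and ?E = "chain_graph G \<sigma>"
  let ?r = "{(x, y). x \<in> ?V \<and> y \<in> ?V \<and> (x, y) \<in> ?E\<^sup>* \<and> (y, x) \<in> ?E\<^sup>*}"
  {
    assume C: "C \<in> recurrent_classes G \<sigma>"
    then obtain x where x: "x \<in> ?V" "C = ?r `` {x}"
      unfolding recurrent_classes_def sccs_def quotient_def by auto
    have "x \<in> C" using x by auto
    moreover have "(y, z) \<in> ?E\<^sup>*" if "y \<in> C" "z \<in> C" for y z
      using that x(2) rtrancl_trans[of y x ?E z] by simp
    moreover have "C \<subseteq> ?V" using x by auto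
    ultimately show ?R using C by (auto simp: recurrent_classes_def)
  }
  assume R: ?R
  then obtain x where x: "x \<in> C" by auto
  have "C = ?r `` {x}"
  proof
    show "C \<subseteq> ?r `` {x}" using R x by blast
    show "?r `` {x} \<subseteq> C"
    proof
      fix y assume "y \<in> ?r `` {x}"
      then have "(x, y) \<in> ?E\<^sup>*" by simp
      with R x show "y \<in> C" by (intro closed_rtrancl[of ?E C x y]) simp_all
    qed
  qed
  moreover have "x \<in> ?V" using R x by blast
  then have "?r `` {x} \<in> sccs ?V ?E" unfolding sccs_def by (rule quotientI)
  ultimately have "C \<in> sccs ?V ?E" by (simp only:)
  with R show "C \<in> recurrent_classes G \<sigma>" by (simp add: recurrent_classes_def)
qed

lemma recurrent_classes_eq:
  assumes "C \<in> recurrent_classes G \<sigma>" "C' \<in> recurrent_classes G \<sigma>" "x \<in> C" "x \<in> C'"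
  shows "C = C'"
proof -
  have "D \<subseteq> D'" if "D \<in> recurrent_classes G \<sigma>" "D' \<in> recurrent_classes G \<sigma>" "x \<in> D" "x \<in> D'" for D D'
  proof
    fix y assume "y \<in> D"
    then have "(x, y) \<in> (chain_graph G \<sigma>)\<^sup>*" using that by (simp add: recurrent_classes_iff)
    with that show "y \<in> D'" 
      by (intro closed_rtrancl[of "chain_graph G \<sigma>" D' x y]) (simp_all add: recurrent_classes_iff)
  qed
  from this[OF assms] this[OF assms(2,1,4,3)] show ?thesis by (rule subset_antisym)
qed

lemma Rec_mono: "(x, y) \<in> (chain_graph G \<sigma>)\<^sup>* \<Longrightarrow> Rec G \<sigma> y \<subseteq> Rec G \<sigma> x"
  unfolding Rec_def by (auto intro: rtrancl_trans)

text \<open>This is why the recorded color sets form a singleton, and stay frozen, once the recorded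
  bit is 1.\<close>

lemma Rec_recurrent:
  assumes "C \<in> recurrent_classes G \<sigma>" "x \<in> C"
  shows "Rec G \<sigma> x = {C}"
proof
  show "Rec G \<sigma> x \<subseteq> {C}"
  proof
    fix C' assume "C' \<in> Rec G \<sigma> x"
    then obtain y where y: "C' \<in> recurrent_classes G \<sigma>" "y \<in> C'" "(x, y) \<in> (chain_graph G \<sigma>)\<^sup>*"
      by (auto simp: Rec_def)
    then have "y \<in> C"
      using assms by (intro closed_rtrancl[of "chain_graph G \<sigma>" C x y]) (simp_all add: recurrent_classes_iff)
    then show "C' \<in> {C}" using recurrent_classes_eq[OF assms(1) y(1) _ y(2)] by simp
  qed
qed (use assms in \<open>auto simp: Rec_def\<close>)

text \<open>Among the points reachable from \<open>x\<close>, take \<open>y\<close> with the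
  smallest reachable set. No point reachable from \<open>y\<close> can reach less, so the set
  reachable from \<open>y\<close> is strongly connected.\<close>

lemma Rec_nonempty:
  assumes "is_pomdp G" "finite_memory G \<sigma>" "x \<in> states G \<times> memory \<sigma>"
  shows "Rec G \<sigma> x \<noteq> {}"
proof -
  let ?V = "states G \<times> memory \<sigma>" and ?E = "chain_graph G \<sigma>"
  let ?R = "\<lambda>y. ?E\<^sup>* `` {y}"
  have fin: "finite ?V" using assms by (auto simp: is_pomdp_def finite_memory_def)
  have V: "?R y \<subseteq> ?V" if "y \<in> ?V" for y
    using that closed_rtrancl[of ?E ?V y] chain_graph_subset[of G \<sigma>] by blast
  obtain y where y: "y \<in> ?R x" "\<And>z. z \<in> ?R x \<Longrightarrow> card (?R y) \<le> card (?R z)"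
    using ex_has_least_nat[of "\<lambda>y. y \<in> ?R x" x "\<lambda>y. card (?R y)"] by auto
  have sc: "y \<in> ?R z" if "z \<in> ?R y" for z
  proof -
    have "?R z \<subseteq> ?R y" using that by (auto intro: rtrancl_trans)
    moreover have "finite (?R y)" using finite_subset[OF V fin] V[OF assms(3)] y(1) by auto
    moreover have "z \<in> ?R x" using that y(1) by (auto intro: rtrancl_trans)
    ultimately have "?R z = ?R y" using y(2) by (intro card_seteq) auto
    then show ?thesis by auto
  qed
  have "?R y \<in> recurrent_classes G \<sigma>" unfolding recurrent_classes_iff
  proof (intro conjI ballI)
    show "?R y \<subseteq> ?V" using V V[OF assms(3)] y(1) by blast
    show "?E `` ?R y \<subseteq> ?R y" by (auto intro: rtrancl_into_rtrancl)
    fix u v assume "u \<in> ?R y" "v \<in> ?R y"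
    then show "(u, v) \<in> ?E\<^sup>*" using sc[of u] by (auto intro: rtrancl_trans)
  qed auto
  then have "?R y \<in> Rec G \<sigma> x" using y(1) by (auto simp: Rec_def intro!: bexI[of _ y])
  then show ?thesis by auto
qed

text \<open>Pigeonhole. \<open>P\<close> keeps a property of the index, such as the value at the
  next time; with a constant \<open>f\<close> this is the bare existence of a recurring
  value.\<close>

lemma INFM_vimage_finite:
  fixes w :: "nat \<Rightarrow> 'x"
  assumes "\<exists>\<^sub>\<infinity>i. f (w i) = z \<and> P i" "range w \<subseteq> X" "finite X"
  shows "\<exists>t. f t = z \<and> (\<exists>\<^sub>\<infinity>i. w i = t \<and> P i)"
proof -
  let ?A = "{i. f (w i) = z \<and> P i}"
  have "infinite ?A" using assms(1) by (simp add: INFM_iff_infinite)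
  moreover have "finite (w ` ?A)" by (rule finite_subset[OF _ assms(3)]) (use assms(2) in auto)
  ultimately obtain j where j: "j \<in> ?A" "infinite {i \<in> ?A. w i = w j}"
    using pigeonhole_infinite[of ?A w] by blast
  then have "{i \<in> ?A. w i = w j} \<subseteq> {i. w i = w j \<and> P i}" by auto
  with j(2) have "infinite {i. w i = w j \<and> P i}" using finite_subset by blast
  with j(1) show ?thesis by (auto simp: INFM_iff_infinite)
qed

section \<open>Runs, configurations and limit sets\<close>

definition play_of :: "(nat \<Rightarrow> 's \<times> 'm \<times> 'a) \<Rightarrow> nat \<Rightarrow> 's \<times> 'a" where
  "play_of \<omega> = (\<lambda>i. (fst (\<omega> i), snd (snd (\<omega> i))))"

definition config :: "'s \<times> 'm \<times> 'a \<Rightarrow> 's \<times> 'm" where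
  "config = (\<lambda>(s, m, a). (s, m))"

text \<open>The law of a run lives on triples that include the sampled action, whereas recurrence is
  defined on pairs; the lemmas below pass between the two chains.\<close>

locale strategy_chain =
  fixes G :: "('s, 'a, 'o) pomdp" and \<sigma> :: "('m, 'o, 'a) strategy"
  assumes pomdp: "is_pomdp G" and fin_mem: "finite_memory G \<sigma>"
begin

sublocale finite_chain "run_measure G \<sigma>" "run_init G \<sigma>" "run_step G \<sigma>" "states G \<times> memory \<sigma> \<times> actions G"
  by (rule finite_chain_run[OF pomdp fin_mem])

abbreviation "E \<equiv> chain_graph G \<sigma>"
abbreviation "x0 \<equiv> (start G, minit \<sigma>)"

lemma typical_runs: "typical \<omega> \<Longrightarrow> \<omega> \<in> runs G \<sigma>"
  by (simp add: typical_def runs_def)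

lemma runs_carrier:
  assumes "\<omega> \<in> runs G \<sigma>"
  shows "\<omega> i \<in> states G \<times> memory \<sigma> \<times> actions G"
proof (induction i)
  case 0
  then show ?case using assms set_pmf_I by (auto simp: runs_def)
next
  case (Suc i)
  then show ?case using assms set_pmf_K[of "\<omega> i"] by (auto simp: runs_def)
qed

lemma runs_select:
  assumes "\<omega> \<in> runs G \<sigma>"
  shows "snd (snd (\<omega> i)) \<in> set_pmf (select \<sigma> (fst (snd (\<omega> i))))"
proof (cases i)
  case 0
  have "\<omega> 0 \<in> set_pmf (run_init G \<sigma>)" using assms by (simp add: runs_def)
  then show ?thesis using 0 by (cases "\<omega> 0") (simp add: mem_run_init_iff)
next
  case (Suc j)
  have "\<omega> (Suc j) \<in> set_pmf (run_step G \<sigma> (\<omega> j))" using assms by (simp add: runs_def)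
  then show ?thesis using Suc by (cases "\<omega> j"; cases "\<omega> (Suc j)") (simp add: mem_run_step_iff)
qed

lemma run_step_chain_graph:
  assumes "x \<in> states G \<times> memory \<sigma> \<times> actions G" "snd (snd x) \<in> set_pmf (select \<sigma> (fst (snd x)))"
    "y \<in> set_pmf (run_step G \<sigma> x)"
  shows "(config x, config y) \<in> E"
proof -
  obtain s m a s' m' a' where xy: "x = (s, m, a)" "y = (s', m', a')" by (cases x, cases y)
  have "y \<in> states G \<times> memory \<sigma> \<times> actions G" using assms(1,3) set_pmf_K by blast
  then show ?thesis
    using assms unfolding xy by (auto simp: config_def chain_graph_iff[OF pomdp] mem_run_step_iff)
qed

lemma runs_chain_graph: "\<omega> \<in> runs G \<sigma> \<Longrightarrow> (config (\<omega> i), config (\<omega> (Suc i))) \<in> E"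
  using runs_carrier runs_select by (intro run_step_chain_graph) (auto simp: runs_def)

lemma runs_chain_graph_rtrancl:
  assumes "\<omega> \<in> runs G \<sigma>" "i \<le> j"
  shows "(config (\<omega> i), config (\<omega> j)) \<in> E\<^sup>*"
  using assms(2) by (induction rule: dec_induct) (auto intro: rtrancl_into_rtrancl runs_chain_graph[OF assms(1)])

lemma runs_config_0: "\<omega> \<in> runs G \<sigma> \<Longrightarrow> config (\<omega> 0) = x0"
  by (cases "\<omega> 0") (auto simp: runs_def config_def mem_run_init_iff)

text \<open>Closure under edges is the delicate point. Typicality concerns triples, and the triple
  seen infinitely often at \<open>(s, m)\<close> may carry an action other than the one of the edge.
  A triple \<open>u\<close> that infinitely often precedes this configuration has every
  \<open>(s, m, a)\<close> with \<open>a\<close> in the support as a successor, so all of these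
  recur as well.\<close>

lemma typical_recurrent:
  assumes "typical \<omega>"
  shows "{x. \<exists>\<^sub>\<infinity>i. config (\<omega> i) = x} \<in> recurrent_classes G \<sigma>"
proof -
  let ?C = "{x. \<exists>\<^sub>\<infinity>i. config (\<omega> i) = x}"
  note run = typical_runs[OF assms]
  have range: "range \<omega> \<subseteq> states G \<times> memory \<sigma> \<times> actions G" using runs_carrier[OF run] by blast
  have step: "\<exists>\<^sub>\<infinity>i. \<omega> i = y" if "\<exists>\<^sub>\<infinity>i. \<omega> i = x" "y \<in> set_pmf (run_step G \<sigma> x)" for x y
    using assms that unfolding typical_def by blast
  obtain t where "\<exists>\<^sub>\<infinity>i. \<omega> i = t"
    using INFM_vimage_finite[of "\<lambda>_. ()" \<omega> "()" "\<lambda>_. True", OF _ range finite_X] by auto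
  then have "\<exists>\<^sub>\<infinity>i. config (\<omega> i) = config t" by (rule INFM_mono) simp
  then have ne: "?C \<noteq> {}" by blast
  have sub: "?C \<subseteq> states G \<times> memory \<sigma>"
  proof
    fix x assume "x \<in> ?C"
    then obtain i where "config (\<omega> i) = x" by (auto dest: INFM_EX)
    then show "x \<in> states G \<times> memory \<sigma>" using runs_carrier[OF run, of i] by (auto simp: config_def)
  qed
  have closed: "y \<in> ?C" if "x \<in> ?C" "(x, y) \<in> E" for x y
  proof -
    obtain s m s' m' where xy: "x = (s, m)" "y = (s', m')" by (cases x, cases y)
    from that(1) have "\<exists>\<^sub>\<infinity>i. config (\<omega> i) = (s, m) \<and> True" by (simp add: xy)
    from INFM_vimage_finite[OF this range finite_X]
    obtain t where t: "config t = (s, m)" "\<exists>\<^sub>\<infinity>i. \<omega> i = t" by (elim exE conjE) simp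
    then have "\<exists>\<^sub>\<infinity>i. \<omega> (Suc i) = t"
      unfolding INFM_nat by (metis Suc_less_eq2 less_Suc_eq)
    then obtain u where u: "\<exists>\<^sub>\<infinity>i. \<omega> i = u \<and> \<omega> (Suc i) = t"
      using INFM_vimage_finite[of "\<lambda>_. ()" \<omega> "()" "\<lambda>i. \<omega> (Suc i) = t", OF _ range finite_X] by auto
    then have u': "\<exists>\<^sub>\<infinity>i. \<omega> i = u" by (rule INFM_mono) simp
    from u obtain i where "\<omega> i = u" "\<omega> (Suc i) = t" by (auto dest: INFM_EX)
    then have tu: "t \<in> set_pmf (run_step G \<sigma> u)" using run by (auto simp: runs_def)
    from that(2) obtain a where a: "a \<in> set_pmf (select \<sigma> m)" "s' \<in> set_pmf (trans G s a)"
      "m' \<in> set_pmf (update \<sigma> m (obs G s') a)" unfolding xy by (auto simp: chain_graph_iff[OF pomdp])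
    have "(s, m, a) \<in> set_pmf (run_step G \<sigma> u)"
      using tu t(1) a(1) by (cases u; cases t) (simp add: mem_run_step_iff config_def)
    then have sma: "\<exists>\<^sub>\<infinity>i. \<omega> i = (s, m, a)" using step[OF u'] by blast
    obtain a' where "a' \<in> set_pmf (select \<sigma> m')" using set_pmf_not_empty by fastforce
    with a have "(s', m', a') \<in> set_pmf (run_step G \<sigma> (s, m, a))" by (simp add: mem_run_step_iff)
    from step[OF sma this] have "\<exists>\<^sub>\<infinity>i. config (\<omega> i) = y"
      by (rule INFM_mono) (simp add: config_def xy)
    then show ?thesis by simp
  qed
  have "(x, y) \<in> E\<^sup>*" if xC: "x \<in> ?C" and yC: "y \<in> ?C" for x y
  proof -
    from xC have "\<exists>\<^sub>\<infinity>i. config (\<omega> i) = x" by simp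
    then obtain i where i: "config (\<omega> i) = x" using INFM_EX by blast
    obtain j where "j > i" "config (\<omega> j) = y" using yC by (auto simp: INFM_nat)
    then show ?thesis using runs_chain_graph_rtrancl[OF run, of i j] i by auto
  qed
  then show ?thesis unfolding recurrent_classes_iff using ne sub closed by blast
qed

lemma inf_states_play_of:
  assumes "\<omega> \<in> runs G \<sigma>"
  shows "inf_states (play_of \<omega>) = fst ` {x. \<exists>\<^sub>\<infinity>i. config (\<omega> i) = x}" (is "_ = fst ` ?C")
proof
  have range: "range \<omega> \<subseteq> states G \<times> memory \<sigma> \<times> actions G" using runs_carrier[OF assms] by blast
  show "inf_states (play_of \<omega>) \<subseteq> fst ` ?C"
  proof
    fix s assume "s \<in> inf_states (play_of \<omega>)"
    then obtain t where t: "fst t = s" "\<exists>\<^sub>\<infinity>i. \<omega> i = t"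
      using INFM_vimage_finite[of fst \<omega> s "\<lambda>_. True", OF _ range finite_X]
      by (auto simp: inf_states_def play_of_def)
    from t(2) have "\<exists>\<^sub>\<infinity>i. config (\<omega> i) = config t" by (rule INFM_mono) simp
    moreover have "fst (config t) = s" using t(1) by (cases t) (auto simp: config_def)
    ultimately show "s \<in> fst ` ?C" by force
  qed
  show "fst ` ?C \<subseteq> inf_states (play_of \<omega>)"
  proof clarify
    fix s m assume "\<exists>\<^sub>\<infinity>i. config (\<omega> i) = (s, m)"
    then have "\<exists>\<^sub>\<infinity>i. fst (play_of \<omega> i) = s"
      by (rule INFM_mono) (auto simp: play_of_def config_def split: prod.splits)
    then show "fst (s, m) \<in> inf_states (play_of \<omega>)" by (simp add: inf_states_def)
  qed
qed

lemma runs_plays: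
  assumes "\<omega> \<in> runs G \<sigma>"
  shows "play_of \<omega> \<in> plays G"
proof -
  have "snd (snd (\<omega> i)) \<in> actions G" for i using runs_carrier[OF assms, of i] by auto
  moreover have "fst (\<omega> (Suc i)) \<in> set_pmf (trans G (fst (\<omega> i)) (snd (snd (\<omega> i))))" for i
  proof -
    have "\<omega> (Suc i) \<in> set_pmf (run_step G \<sigma> (\<omega> i))" using assms by (simp add: runs_def)
    then show ?thesis by (cases "\<omega> i"; cases "\<omega> (Suc i)") (simp add: mem_run_step_iff)
  qed
  moreover have "fst (\<omega> 0) = start G" using runs_config_0[OF assms] by (cases "\<omega> 0") (auto simp: config_def)
  ultimately show ?thesis by (simp add: plays_def play_of_def pmf_positive)
qed

text \<open>The limit class is visited after every time \<open>i\<close>, so it is reachable from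
  each configuration passed. Hence a single visit to a recurrent class determines it.\<close>

lemma typical_class:
  assumes "typical \<omega>"
  obtains C where "\<And>i. C \<in> Rec G \<sigma> (config (\<omega> i))" "C \<in> Rec G \<sigma> x0"
    "play_of \<omega> \<in> muller G col \<F> \<longleftrightarrow> col ` fst ` C \<in> \<F>"
proof -
  define C where "C = {x. \<exists>\<^sub>\<infinity>i. config (\<omega> i) = x}"
  note run = typical_runs[OF assms]
  have C: "C \<in> recurrent_classes G \<sigma>" unfolding C_def by (rule typical_recurrent[OF assms])
  then obtain x where "x \<in> C" by (auto simp: recurrent_classes_iff)
  have Rec: "C \<in> Rec G \<sigma> (config (\<omega> i))" for i
  proof -
    obtain j where "j > i" "config (\<omega> j) = x" using \<open>x \<in> C\<close> by (auto simp: C_def INFM_nat)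
    with runs_chain_graph_rtrancl[OF run, of i j] show ?thesis using C \<open>x \<in> C\<close> by (auto simp: Rec_def)
  qed
  show thesis
  proof
    show "C \<in> Rec G \<sigma> x0" using Rec[of 0] runs_config_0[OF run] by simp
    show "play_of \<omega> \<in> muller G col \<F> \<longleftrightarrow> col ` fst ` C \<in> \<F>"
      using runs_plays[OF run] by (simp add: muller_def inf_states_play_of[OF run] C_def)
  qed (rule Rec)
qed

lemma ex_run_visiting:
  assumes "(x0, x) \<in> E\<^sup>*" "AE \<omega> in run_measure G \<sigma>. Q \<omega>"
  shows "\<exists>\<omega> n. typical \<omega> \<and> Q \<omega> \<and> config (\<omega> n) = x"
proof -
  let ?K = "{(x, y). y \<in> set_pmf (run_step G \<sigma> x)}"
  \<comment> \<open>The induction covers every supported action at the end point, because the next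
    edge dictates which action must have been sampled.\<close>
  have "\<forall>a\<in>set_pmf (select \<sigma> (snd x)). \<exists>r\<in>set_pmf (run_init G \<sigma>). (r, (fst x, snd x, a)) \<in> ?K\<^sup>*"
    using assms(1)
  proof (induction rule: rtrancl_induct)
    case base
    show ?case by (auto simp: run_init_def)
  next
    case (step y z)
    obtain s m s' m' where yz: "y = (s, m)" "z = (s', m')" by (cases y, cases z)
    from step(2) obtain a where a: "a \<in> set_pmf (select \<sigma> m)" "s' \<in> set_pmf (trans G s a)"
      "m' \<in> set_pmf (update \<sigma> m (obs G s') a)" unfolding yz by (auto simp: chain_graph_iff[OF pomdp])
    then obtain r where r: "r \<in> set_pmf (run_init G \<sigma>)" "(r, (s, m, a)) \<in> ?K\<^sup>*"
      using step.IH yz by auto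
    show ?case
    proof
      fix a' assume "a' \<in> set_pmf (select \<sigma> (snd z))"
      then have "((s, m, a), (fst z, snd z, a')) \<in> ?K" using a yz by (simp add: mem_run_step_iff)
      with r show "\<exists>r\<in>set_pmf (run_init G \<sigma>). (r, (fst z, snd z, a')) \<in> ?K\<^sup>*"
        by (blast intro: rtrancl_into_rtrancl)
    qed
  qed
  moreover obtain a where "a \<in> set_pmf (select \<sigma> (snd x))" using set_pmf_not_empty by fastforce
  ultimately obtain r where "r \<in> set_pmf (run_init G \<sigma>)" "(r, (fst x, snd x, a)) \<in> ?K\<^sup>*" by blast
  moreover have "AE \<omega> in run_measure G \<sigma>. typical \<omega> \<and> Q \<omega>" using AE_typical assms(2) by (rule AE_conjI)
  ultimately obtain \<omega> n where "typical \<omega> \<and> Q \<omega>" "\<omega> n = (fst x, snd x, a)"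
    using ex_visiting[of r "(fst x, snd x, a)" "\<lambda>\<omega>. typical \<omega> \<and> Q \<omega>"] by blast
  then show ?thesis by (intro exI[of _ \<omega>] exI[of _ n]) (simp add: config_def)
qed

text \<open>A typical run through a point of \<open>C\<close> has limit class \<open>C\<close>,
  since no other class is reachable from there.\<close>

lemma ex_run_class:
  assumes "C \<in> Rec G \<sigma> x0" "AE \<omega> in run_measure G \<sigma>. Q \<omega>"
  shows "\<exists>\<omega>. Q \<omega> \<and> (play_of \<omega> \<in> muller G col \<F> \<longleftrightarrow> col ` fst ` C \<in> \<F>)"
proof -
  obtain x where x: "x \<in> C" "(x0, x) \<in> E\<^sup>*" "C \<in> recurrent_classes G \<sigma>" using assms(1) by (auto simp: Rec_def)
  obtain \<omega> n where \<omega>: "typical \<omega>" "Q \<omega>" "config (\<omega> n) = x" using ex_run_visiting[OF x(2) assms(2)] by blast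
  obtain C' where C': "\<And>i. C' \<in> Rec G \<sigma> (config (\<omega> i))"
    "play_of \<omega> \<in> muller G col \<F> \<longleftrightarrow> col ` fst ` C' \<in> \<F>" using typical_class[OF \<omega>(1)] by metis
  have "C' = C" using C'(1)[of n] Rec_recurrent[OF x(3,1)] \<omega>(3) by auto
  with C' \<omega> show ?thesis by blast
qed

section \<open>Winning criteria in terms of reachable recurrent classes\<close>

lemma measure_play_muller:
  "measure (play_measure G \<sigma>) (muller G col \<F>) = prob {\<omega>. play_of \<omega> \<in> muller G col \<F>}"
  "{\<omega>. play_of \<omega> \<in> muller G col \<F>} \<in> events"
proof -
  have meas: "muller G col \<F> \<in> sets (PiM UNIV (\<lambda>_. count_space UNIV))"
    using muller_in_sets[OF pomdp] by (simp add: sets_play_measure)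
  have vim: "(\<lambda>\<omega> i. (fst (\<omega> i), snd (snd (\<omega> i)))) -` muller G col \<F> \<inter> space (run_measure G \<sigma>)
      = {\<omega>. play_of \<omega> \<in> muller G col \<F>}"
    by (auto simp: play_of_def space_M)
  show "measure (play_measure G \<sigma>) (muller G col \<F>) = prob {\<omega>. play_of \<omega> \<in> muller G col \<F>}"
    unfolding play_measure_def measure_distr[OF measurable_play_of_run meas] vim ..
  show "{\<omega>. play_of \<omega> \<in> muller G col \<F>} \<in> events"
    using measurable_sets[OF measurable_play_of_run[of G \<sigma>] meas] unfolding vim .
qed

theorem almost_sure_winning_iff:
  "almost_sure_winning G \<sigma> (muller G col \<F>) \<longleftrightarrow> (\<forall>C\<in>Rec G \<sigma> x0. col ` fst ` C \<in> \<F>)"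
proof -
  let ?W = "{\<omega>. play_of \<omega> \<in> muller G col \<F>}"
  have iff: "almost_sure_winning G \<sigma> (muller G col \<F>) \<longleftrightarrow> (AE \<omega> in run_measure G \<sigma>. \<omega> \<in> ?W)"
    unfolding almost_sure_winning_def measure_play_muller(1)
    using prob_eq_1[OF measure_play_muller(2)] by blast
  show ?thesis unfolding iff
  proof (intro iffI ballI)
    fix C assume W: "AE \<omega> in run_measure G \<sigma>. \<omega> \<in> ?W" and C: "C \<in> Rec G \<sigma> x0"
    from ex_run_class[OF C W, of col \<F>] show "col ` fst ` C \<in> \<F>" by auto
  next
    assume R: "\<forall>C\<in>Rec G \<sigma> x0. col ` fst ` C \<in> \<F>"
    show "AE \<omega> in run_measure G \<sigma>. \<omega> \<in> ?W" using AE_typical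
    proof eventually_elim
      case (elim \<omega>)
      then show ?case using typical_class[of \<omega> col \<F>] R by auto
    qed
  qed
qed

text \<open>Positive probability means that the complement is not almost sure, so the two facts on
  typical runs apply in contraposed form.\<close>

theorem positive_winning_iff:
  "positive_winning G \<sigma> (muller G col \<F>) \<longleftrightarrow> (\<exists>C\<in>Rec G \<sigma> x0. col ` fst ` C \<in> \<F>)"
proof -
  let ?W = "{\<omega>. play_of \<omega> \<in> muller G col \<F>}"
  have iff: "positive_winning G \<sigma> (muller G col \<F>) \<longleftrightarrow> \<not> (AE \<omega> in run_measure G \<sigma>. \<omega> \<notin> ?W)"
    unfolding positive_winning_def measure_play_muller(1)
    using prob_eq_0[OF measure_play_muller(2)] by (simp add: zero_less_measure_iff)
  show ?thesis unfolding iff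
  proof
    assume W: "\<not> (AE \<omega> in run_measure G \<sigma>. \<omega> \<notin> ?W)"
    show "\<exists>C\<in>Rec G \<sigma> x0. col ` fst ` C \<in> \<F>"
    proof (rule ccontr)
      assume R: "\<not> (\<exists>C\<in>Rec G \<sigma> x0. col ` fst ` C \<in> \<F>)"
      have "AE \<omega> in run_measure G \<sigma>. \<omega> \<notin> ?W" using AE_typical
      proof eventually_elim
        case (elim \<omega>)
        then show ?case using typical_class[of \<omega> col \<F>] R by auto
      qed
      with W show False by simp
    qed
  next
    assume "\<exists>C\<in>Rec G \<sigma> x0. col ` fst ` C \<in> \<F>"
    then obtain C where C: "C \<in> Rec G \<sigma> x0" "col ` fst ` C \<in> \<F>" by blast
    show "\<not> (AE \<omega> in run_measure G \<sigma>. \<omega> \<notin> ?W)"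
    proof
      assume "AE \<omega> in run_measure G \<sigma>. \<omega> \<notin> ?W"
      from ex_run_class[OF C(1) this, of col \<F>] C(2) show False by auto
    qed
  qed
qed

end

context strategy_chain
begin

lemma ex_succ:
  assumes "x \<in> states G \<times> memory \<sigma>"
  shows "\<exists>y. (x, y) \<in> E"
proof -
  obtain s m where x: "x = (s, m)" by (cases x)
  with assms have sm: "s \<in> states G" "m \<in> memory \<sigma>" by auto
  obtain a where a: "a \<in> set_pmf (select \<sigma> m)" using set_pmf_not_empty by fastforce
  have aG: "a \<in> actions G" using a sm(2) fin_mem by (auto simp: finite_memory_def)
  have "(s, m, a) \<in> states G \<times> memory \<sigma> \<times> actions G" using sm aG by simp
  moreover obtain y where "y \<in> set_pmf (run_step G \<sigma> (s, m, a))" using set_pmf_not_empty by fastforce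
  ultimately have "(config (s, m, a), config y) \<in> E" using a by (intro run_step_chain_graph) auto
  then have "(x, config y) \<in> E" by (simp add: config_def x)
  then show ?thesis ..
qed

lemma recurrent_class_ex_succ:
  assumes "C \<in> recurrent_classes G \<sigma>" "x \<in> C"
  shows "\<exists>y\<in>C. (x, y) \<in> E"
proof -
  have "x \<in> states G \<times> memory \<sigma>" using assms unfolding recurrent_classes_iff by blast
  then obtain y where "(x, y) \<in> E" using ex_succ by blast
  moreover have "y \<in> C"
    using assms \<open>(x, y) \<in> E\<close> by (intro closed_rtrancl[of E C x y]) (simp_all add: recurrent_classes_iff)
  ultimately show ?thesis by blast
qed

text \<open>The class leads back from \<open>y\<close> to \<open>x\<close> without leaving
  \<open>A\<close>. In both examples this shows that the bad state is not recurrent.\<close>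

lemma recurrent_class_avoid:
  assumes "C \<in> recurrent_classes G \<sigma>" "x \<in> C" "E `` A \<subseteq> A" "(x, y) \<in> E" "y \<in> A"
  shows "x \<in> A"
proof -
  have "y \<in> C"
    using assms by (intro closed_rtrancl[of E C x y]) (simp_all add: recurrent_classes_iff)
  then have "(y, x) \<in> E\<^sup>*" using assms(1,2) by (simp add: recurrent_classes_iff)
  with assms(3,5) show ?thesis by (rule closed_rtrancl)
qed

end

lemma almost_sure_imp_positive: "almost_sure_winning G \<sigma> \<phi> \<Longrightarrow> positive_winning G \<sigma> \<phi>"
  by (simp add: almost_sure_winning_def positive_winning_def)

section \<open>The projected strategy\<close>

locale projection = strategy_chain G \<sigma>
  for G :: "('s, 'a, 'o) pomdp" and \<sigma> :: "('m, 'o, 'a) strategy" +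
  fixes col :: "'s \<Rightarrow> 'd"
begin

abbreviation "vertex \<equiv> proj_vertex G col \<sigma>"
abbreviation "P \<equiv> proj_strategy G col \<sigma>"

text \<open>The one-step belief update, which is the \<open>U'\<close> of the projection
  graph.\<close>

definition post :: "'s set \<Rightarrow> 'a \<Rightarrow> 'o \<Rightarrow> 's set" where
  "post U a ob = obs_class G ob \<inter> (\<Union>s\<in>U. set_pmf (trans G s a))"

lemma fst_vertex [simp]: "fst (vertex U m) = U"
  by (simp add: proj_vertex_def)

lemma post_subset: "post U a ob \<subseteq> states G"
  by (auto simp: post_def obs_class_def)

lemma proj_edgesI:
  assumes "U \<subseteq> states G" "m \<in> memory \<sigma>" "a \<in> set_pmf (select \<sigma> m)" "ob \<in> observations G"
    "m' \<in> set_pmf (update \<sigma> m ob a)"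
  shows "(vertex U m, a, vertex (post U a ob) m') \<in> proj_edges G col \<sigma>"
  unfolding proj_edges_def post_def using assms by blast

text \<open>A vertex determines \<open>U\<close> but not the memory: the edge may stem from another
  memory \<open>m1\<close>, of which only the equality of vertices is known.\<close>

lemma proj_edgesE:
  assumes "(vertex U m, a, v') \<in> proj_edges G col \<sigma>"
  obtains m1 m' ob where "vertex U m = vertex U m1" "m1 \<in> memory \<sigma>" "a \<in> set_pmf (select \<sigma> m1)"
    "ob \<in> observations G" "m' \<in> set_pmf (update \<sigma> m1 ob a)" "v' = vertex (post U a ob) m'"
proof -
  from assms obtain U1 m1 m' ob where *: "vertex U m = vertex U1 m1" "m1 \<in> memory \<sigma>" "a \<in> set_pmf (select \<sigma> m1)"
    "ob \<in> observations G" "m' \<in> set_pmf (update \<sigma> m1 ob a)" "v' = vertex (post U1 a ob) m'"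
    unfolding proj_edges_def post_def by blast
  from *(1) have "fst (vertex U m) = fst (vertex U1 m1)" by simp
  then have "U = U1" by simp
  with * that show thesis by blast
qed

lemma proj_verticesI: "U \<subseteq> states G \<Longrightarrow> m \<in> memory \<sigma> \<Longrightarrow> vertex U m \<in> proj_vertices G col \<sigma>"
  by (auto simp: proj_vertices_def)

lemma proj_verticesE:
  assumes "v \<in> proj_vertices G col \<sigma>"
  obtains U m where "v = vertex U m" "U \<subseteq> states G" "m \<in> memory \<sigma>"
  using assms by (auto simp: proj_vertices_def)

lemma select_actions: "m \<in> memory \<sigma> \<Longrightarrow> a \<in> set_pmf (select \<sigma> m) \<Longrightarrow> a \<in> actions G"
  using fin_mem by (auto simp: finite_memory_def)

lemma update_memory:
  assumes "m \<in> memory \<sigma>" "a \<in> actions G" "ob \<in> observations G" "m' \<in> set_pmf (update \<sigma> m ob a)"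
  shows "m' \<in> memory \<sigma>"
  using assms fin_mem unfolding finite_memory_def by blast

lemma finite_proj_vertices: "finite (proj_vertices G col \<sigma>)"
proof -
  have "proj_vertices G col \<sigma> = case_prod vertex ` (Pow (states G) \<times> memory \<sigma>)"
    by (auto simp: proj_vertices_def)
  then show ?thesis using pomdp fin_mem by (simp add: is_pomdp_def finite_memory_def)
qed

lemma set_select_proj:
  assumes "U \<subseteq> states G" "m \<in> memory \<sigma>"
  shows "set_pmf (select P (vertex U m)) =
    {a \<in> actions G. \<exists>v'\<in>proj_vertices G col \<sigma>. (vertex U m, a, v') \<in> proj_edges G col \<sigma>}" (is "_ = ?A")
proof -
  obtain a where a: "a \<in> set_pmf (select \<sigma> m)" using set_pmf_not_empty by fastforce
  \<comment> \<open>Any observation will do for an outgoing edge; the belief it leads to may be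
    empty, which the set of enabled actions tolerates.\<close>
  have ob: "obs G (start G) \<in> observations G" using pomdp by (auto simp: is_pomdp_def)
  obtain m' where m': "m' \<in> set_pmf (update \<sigma> m (obs G (start G)) a)" using set_pmf_not_empty by fastforce
  have aG: "a \<in> actions G" by (rule select_actions[OF assms(2) a])
  have "vertex (post U a (obs G (start G))) m' \<in> proj_vertices G col \<sigma>"
    by (rule proj_verticesI[OF post_subset update_memory[OF assms(2) aG ob m']])
  with proj_edgesI[OF assms a ob m'] aG have "a \<in> ?A" by blast
  then have "?A \<noteq> {}" by blast
  moreover have "finite ?A" using pomdp by (simp add: is_pomdp_def)
  ultimately show ?thesis unfolding proj_strategy_def by simp
qed

lemma set_update_proj:
  "set_pmf (update P v ob a) = (if proj_succs G col \<sigma> v ob a = {} then {v} else proj_succs G col \<sigma> v ob a)"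
proof -
  have "finite (proj_succs G col \<sigma> v ob a)"
    using finite_proj_vertices by (simp add: proj_succs_def)
  then show ?thesis by (simp add: proj_strategy_def)
qed

lemma finite_memory_proj: "finite_memory G P"
  unfolding finite_memory_def
proof (intro conjI ballI)
  show "finite (memory P)" by (simp add: proj_strategy_def finite_proj_vertices)
  show "minit P \<in> memory P"
    using pomdp fin_mem by (auto simp: proj_strategy_def is_pomdp_def finite_memory_def intro!: proj_verticesI)
  fix v assume "v \<in> memory P"
  then have v: "v \<in> proj_vertices G col \<sigma>" by (simp add: proj_strategy_def)
  then obtain U m where U: "v = vertex U m" "U \<subseteq> states G" "m \<in> memory \<sigma>" by (rule proj_verticesE)
  show "set_pmf (select P v) \<subseteq> actions G" unfolding U(1) set_select_proj[OF U(2,3)] by blast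
  show "set_pmf (update P v ob a) \<subseteq> memory P" for ob a
    using v by (simp add: set_update_proj) (auto simp: proj_strategy_def proj_succs_def)
qed

text \<open>The recurrence functions are restricted to \<open>states G\<close>, so they lie in
  finite extensional function spaces. Beliefs and bits contribute one factor
  \<open>2 ^ card (states G)\<close> each.\<close>

lemma card_proj_vertices:
  assumes "is_coloring G D col"
  shows "card (proj_vertices G col \<sigma>) \<le> mem_bound G D"
proof -
  have fin: "finite (states G)" using pomdp by (simp add: is_pomdp_def)
  have finD: "finite D" and colD: "col ` states G \<subseteq> D" using assms by (auto simp: is_coloring_def)
  let ?B = "PiE (states G) (\<lambda>_. {0, 1::nat})" and ?L = "PiE (states G) (\<lambda>_. Pow (Pow D))"
  have "col ` fst ` C \<subseteq> D" if "C \<in> recurrent_classes G \<sigma>" for C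
    using that colD unfolding recurrent_classes_iff by fastforce
  then have L: "SetRec G col \<sigma> m \<in> ?L" for m
    by (auto simp: SetRec_def Rec_def PiE_iff subset_iff)
  have B: "BoolRec G \<sigma> m \<in> ?B" for m by (auto simp: BoolRec_def PiE_iff)
  have sub: "proj_vertices G col \<sigma> \<subseteq> Pow (states G) \<times> ?B \<times> ?L"
  proof
    fix v assume "v \<in> proj_vertices G col \<sigma>"
    then obtain U m where "v = (U, BoolRec G \<sigma> m, SetRec G col \<sigma> m)" "U \<subseteq> states G"
      by (auto simp: proj_vertices_def proj_vertex_def)
    with L[of m] B[of m] show "v \<in> Pow (states G) \<times> ?B \<times> ?L" by simp
  qed
  have "card (proj_vertices G col \<sigma>) \<le> card (Pow (states G) \<times> ?B \<times> ?L)"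
    using fin finD by (intro card_mono sub finite_cartesian_product finite_PiE) auto
  also have "\<dots> = mem_bound G D"
    using fin by (simp add: card_cartesian_product card_PiE card_Pow mem_bound_def mult_2 power_add numeral_2_eq_2)
  finally show ?thesis .
qed

section \<open>Projecting edges and lifting paths\<close>

abbreviation "E' \<equiv> chain_graph G P"

lemma project_edge:
  assumes "U \<subseteq> states G" "m \<in> memory \<sigma>" "s \<in> U" "((s, vertex U m), (s', v')) \<in> E'"
  obtains m1 U' m' where "vertex U m = vertex U m1" "m1 \<in> memory \<sigma>" "v' = vertex U' m'" "m' \<in> memory \<sigma>"
    "U' \<subseteq> states G" "s' \<in> U'" "((s, m1), (s', m')) \<in> E"
proof -
  from assms(4) obtain a where a: "s \<in> states G" "s' \<in> states G" "a \<in> actions G" "a \<in> set_pmf (select P (vertex U m))"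
    "s' \<in> set_pmf (trans G s a)" "v' \<in> set_pmf (update P (vertex U m) (obs G s') a)"
    by (auto simp: chain_graph_iff[OF pomdp])
  have ob: "obs G s' \<in> observations G" using a(2) pomdp by (auto simp: is_pomdp_def)
  have s'_post: "s' \<in> post U a (obs G s')" using a assms(3) by (auto simp: post_def obs_class_def)
  from a(4) obtain v2 where "(vertex U m, a, v2) \<in> proj_edges G col \<sigma>" 
    unfolding set_select_proj[OF assms(1,2)] by auto
  then obtain m2 where m2: "vertex U m = vertex U m2" "m2 \<in> memory \<sigma>" "a \<in> set_pmf (select \<sigma> m2)"
    by (elim proj_edgesE)
  obtain m3 where m3: "m3 \<in> set_pmf (update \<sigma> m2 (obs G s') a)" using set_pmf_not_empty by fastforce
  \<comment> \<open>A genuine successor exists, as its belief contains \<open>s'\<close>. So the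
    fallback that leaves the memory unchanged is not taken, and \<open>v'\<close> is a genuine
    successor too.\<close>
  have "vertex (post U a (obs G s')) m3 \<in> proj_succs G col \<sigma> (vertex U m) (obs G s') a"
    using proj_edgesI[OF assms(1) m2(2,3) ob m3] proj_verticesI[OF post_subset update_memory[OF m2(2) a(3) ob m3]]
      s'_post m2(1) by (auto simp: proj_succs_def post_def)
  then have v': "v' \<in> proj_succs G col \<sigma> (vertex U m) (obs G s') a"
    using a(6) by (auto simp: set_update_proj split: if_splits)
  then have "(vertex U m, a, v') \<in> proj_edges G col \<sigma>" by (simp add: proj_succs_def)
  then obtain m1 m' ob where m1: "vertex U m = vertex U m1" "m1 \<in> memory \<sigma>" "a \<in> set_pmf (select \<sigma> m1)"
    "ob \<in> observations G" "m' \<in> set_pmf (update \<sigma> m1 ob a)" "v' = vertex (post U a ob) m'"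
    by (rule proj_edgesE)
  \<comment> \<open>Observation classes are disjoint, so a nonempty belief inside the class of
    \<open>s'\<close> identifies the observation under which the memory was updated.\<close>
  have "post U a ob \<noteq> {}" "post U a ob \<subseteq> obs_class G (obs G s')"
    using v' m1(6) by (auto simp: proj_succs_def)
  then have "ob = obs G s'" by (auto simp: post_def obs_class_def)
  with m1 a s'_post show thesis
    by (intro that[of m1 "post U a ob" m'])
      (auto simp: post_subset chain_graph_iff[OF pomdp] intro: update_memory select_actions)
qed

text \<open>In contrast to \<open>project_edge\<close>, the memories stay as they are and only the
  belief moves, so these edges compose to paths.\<close>

lemma lift_edge:
  assumes "U \<subseteq> states G" "s \<in> U" "((s, m), (s', m')) \<in> E"
  shows "\<exists>U'. U' \<subseteq> states G \<and> s' \<in> U' \<and> ((s, vertex U m), (s', vertex U' m')) \<in> E'"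
proof -
  from assms(3) obtain a where a: "s \<in> states G" "m \<in> memory \<sigma>" "s' \<in> states G" "m' \<in> memory \<sigma>"
    "a \<in> actions G" "a \<in> set_pmf (select \<sigma> m)" "s' \<in> set_pmf (trans G s a)"
    "m' \<in> set_pmf (update \<sigma> m (obs G s') a)"
    by (auto simp: chain_graph_iff[OF pomdp])
  let ?U = "post U a (obs G s')"
  have ob: "obs G s' \<in> observations G" using a(3) pomdp by (auto simp: is_pomdp_def)
  have s': "s' \<in> ?U" using a assms(2) by (auto simp: post_def obs_class_def)
  note edge = proj_edgesI[OF assms(1) a(2,6) ob a(8)]
  note vert = proj_verticesI[OF assms(1) a(2)] proj_verticesI[OF post_subset a(4), of U a "obs G s'"]
  have "vertex ?U m' \<in> proj_succs G col \<sigma> (vertex U m) (obs G s') a"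
    using edge vert s' by (auto simp: proj_succs_def post_def)
  then have "vertex ?U m' \<in> set_pmf (update P (vertex U m) (obs G s') a)"
    by (auto simp: set_update_proj)
  moreover have "a \<in> set_pmf (select P (vertex U m))"
    unfolding set_select_proj[OF assms(1) a(2)] using edge vert a(5) by blast
  moreover have "memory P = proj_vertices G col \<sigma>" by (simp add: proj_strategy_def)
  ultimately have "((s, vertex U m), (s', vertex ?U m')) \<in> E'"
    using a vert by (auto simp: chain_graph_iff[OF pomdp])
  then show ?thesis using s' post_subset by (intro exI[of _ ?U]) simp
qed

lemma lift_path:
  assumes "((s, m), y) \<in> E\<^sup>*" "U \<subseteq> states G" "s \<in> U"
  shows "\<exists>U'. U' \<subseteq> states G \<and> fst y \<in> U' \<and> ((s, vertex U m), (fst y, vertex U' (snd y))) \<in> E'\<^sup>*"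
  using assms(1)
proof (induction rule: rtrancl_induct)
  case base
  then show ?case using assms(2,3) by auto
next
  case (step y z)
  obtain U' where U': "U' \<subseteq> states G" "fst y \<in> U'" "((s, vertex U m), (fst y, vertex U' (snd y))) \<in> E'\<^sup>*"
    using step.IH by blast
  obtain U'' where "U'' \<subseteq> states G" "fst z \<in> U''" "((fst y, vertex U' (snd y)), (fst z, vertex U'' (snd z))) \<in> E'"
    using lift_edge[OF U'(1,2), of "snd y" "fst z" "snd z"] step.hyps by auto
  with U'(3) show ?case by (blast intro: rtrancl_into_rtrancl)
qed

text \<open>\<open>bool_at\<close> and \<open>set_at\<close> read off the recurrence information that the memory of the projected
  strategy records for the current state; \<open>consistent\<close> says that this state lies in the recorded
  belief, so that the record is the one of some configuration of the original chain.\<close>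

definition consistent :: "'s \<times> ('s, 'd) proj_mem \<Rightarrow> bool" where
  "consistent x \<longleftrightarrow> (\<exists>U m. snd x = vertex U m \<and> U \<subseteq> states G \<and> m \<in> memory \<sigma> \<and> fst x \<in> U)"

definition bool_at :: "'s \<times> ('s, 'd) proj_mem \<Rightarrow> nat" where
  "bool_at x = fst (snd (snd x)) (fst x)"

definition set_at :: "'s \<times> ('s, 'd) proj_mem \<Rightarrow> 'd set set" where
  "set_at x = snd (snd (snd x)) (fst x)"

abbreviation colors :: "('s \<times> 'n) set \<Rightarrow> 'd set" where
  "colors C \<equiv> col ` fst ` C"

lemma set_at_vertex: "s \<in> states G \<Longrightarrow> set_at (s, vertex U m) = colors ` Rec G \<sigma> (s, m)"
  by (auto simp: set_at_def proj_vertex_def SetRec_def)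

lemma bool_at_vertex:
  "s \<in> states G \<Longrightarrow> bool_at (s, vertex U m) = 1 \<longleftrightarrow> (\<exists>C\<in>recurrent_classes G \<sigma>. (s, m) \<in> C)"
  by (auto simp: bool_at_def proj_vertex_def BoolRec_def)

text \<open>The record at \<open>x\<close> can be read off any memory with the same vertex, in
  particular off the \<open>m1\<close> that supplies the original edge; along this edge reachable
  classes can only disappear.\<close>

lemma consistent_edge:
  assumes "consistent x" "(x, y) \<in> E'"
  shows "consistent y" "set_at y \<subseteq> set_at x"
    "bool_at x = 1 \<Longrightarrow> bool_at y = 1 \<and> set_at y = set_at x"
proof -
  obtain s U m where x: "x = (s, vertex U m)" "U \<subseteq> states G" "m \<in> memory \<sigma>" "s \<in> U"
    using assms(1) by (cases x) (auto simp: consistent_def)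
  obtain s' v' where y: "y = (s', v')" by (cases y)
  obtain m1 U' m' where *: "vertex U m = vertex U m1" "m1 \<in> memory \<sigma>" "v' = vertex U' m'" "m' \<in> memory \<sigma>"
    "U' \<subseteq> states G" "s' \<in> U'" "((s, m1), (s', m')) \<in> E"
    using assms(2) unfolding x(1) y by (rule project_edge[OF x(2-4)])
  show "consistent y" using * y by (auto simp: consistent_def)
  have S: "s \<in> states G" "s' \<in> states G" using x * by auto
  have xL: "set_at x = colors ` Rec G \<sigma> (s, m1)" and yL: "set_at y = colors ` Rec G \<sigma> (s', m')"
    unfolding x(1) y *(1,3) by (rule set_at_vertex, rule S)+
  show "set_at y \<subseteq> set_at x" unfolding xL yL
    using Rec_mono[of "(s, m1)" "(s', m')"] *(7) by (intro image_mono) auto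
  assume "bool_at x = 1"
  then obtain C where C: "C \<in> recurrent_classes G \<sigma>" "(s, m1) \<in> C"
    unfolding x(1) *(1) bool_at_vertex[OF S(1)] by blast
  then have C': "(s', m') \<in> C" using *(7) by (auto simp: recurrent_classes_iff)
  have "bool_at y = 1" unfolding y *(3) bool_at_vertex[OF S(2)] using C C' by blast
  moreover have "set_at y = set_at x" unfolding xL yL Rec_recurrent[OF C] Rec_recurrent[OF C(1) C'] ..
  ultimately show "bool_at y = 1 \<and> set_at y = set_at x" by simp
qed

lemma consistent_path:
  assumes "(x, y) \<in> E'\<^sup>*" "consistent x"
  shows "consistent y \<and> set_at y \<subseteq> set_at x \<and> (bool_at x = 1 \<longrightarrow> bool_at y = 1 \<and> set_at y = set_at x)"
  using assms(1)
proof (induction rule: rtrancl_induct)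
  case (step y z)
  then show ?case using consistent_edge[of y z] by auto
qed (use assms(2) in simp)

lemma consistent_states: "consistent x \<Longrightarrow> x \<in> states G \<times> memory P"
  by (cases x) (auto simp: consistent_def proj_strategy_def intro: proj_verticesI)

text \<open>Lift a path into a class with colors \<open>Z\<close>. Its end keeps the memory of the
  original path, which witnesses both the bit and the singleton.\<close>

lemma reach_bool_at:
  assumes "consistent x" "Z \<in> set_at x"
  shows "\<exists>y. (x, y) \<in> E'\<^sup>* \<and> bool_at y = 1 \<and> set_at y = {Z}"
proof -
  obtain s U m where x: "x = (s, vertex U m)" "U \<subseteq> states G" "m \<in> memory \<sigma>" "s \<in> U"
    using assms(1) by (cases x) (auto simp: consistent_def)
  then have "s \<in> states G" by auto
  with assms(2) x(1) obtain C where C: "C \<in> Rec G \<sigma> (s, m)" "Z = colors C"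
    using set_at_vertex[of s U m] by auto
  then obtain y where y: "C \<in> recurrent_classes G \<sigma>" "y \<in> C" "((s, m), y) \<in> E\<^sup>*" by (auto simp: Rec_def)
  obtain U' where U': "U' \<subseteq> states G" "fst y \<in> U'" "(x, (fst y, vertex U' (snd y))) \<in> E'\<^sup>*"
    using lift_path[OF y(3) x(2,4)] x(1) by blast
  then have S: "fst y \<in> states G" by blast
  have "bool_at (fst y, vertex U' (snd y)) = 1" unfolding bool_at_vertex[OF S] using y by auto
  moreover have "set_at (fst y, vertex U' (snd y)) = {Z}"
    unfolding set_at_vertex[OF S] using Rec_recurrent[OF y(1,2)] C(2) by simp
  ultimately show ?thesis using U'(3) by blast
qed

text \<open>Bit 1 puts the represented configuration into a class with colors \<open>Z\<close>;
  paths inside this class lift.\<close>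

lemma colors_reach:
  assumes "consistent x" "bool_at x = 1" "set_at x = {Z}"
  shows "col (fst x) \<in> Z" "d \<in> Z \<Longrightarrow> \<exists>y. (x, y) \<in> E'\<^sup>* \<and> col (fst y) = d"
proof -
  obtain s U m where x: "x = (s, vertex U m)" "U \<subseteq> states G" "m \<in> memory \<sigma>" "s \<in> U"
    using assms(1) by (cases x) (auto simp: consistent_def)
  then have S: "s \<in> states G" by auto
  obtain C where C: "C \<in> recurrent_classes G \<sigma>" "(s, m) \<in> C"
    using assms(2) unfolding x(1) bool_at_vertex[OF S] by blast
  have Z: "Z = colors C"
    using assms(3) unfolding x(1) set_at_vertex[OF S] Rec_recurrent[OF C] by simp
  show "col (fst x) \<in> Z" using C(2) x(1) unfolding Z by force
  assume "d \<in> Z"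
  then obtain y where y: "y \<in> C" "col (fst y) = d" unfolding Z by auto
  have "((s, m), y) \<in> E\<^sup>*" using C y(1) by (simp add: recurrent_classes_iff)
  from lift_path[OF this x(2,4)] y(2) show "\<exists>y. (x, y) \<in> E'\<^sup>* \<and> col (fst y) = d"
    unfolding x(1) by (metis fst_conv)
qed

lemma colors_recurrent_proj:
  assumes "C \<in> recurrent_classes G P" "y \<in> C" "consistent y" "bool_at y = 1" "set_at y = {Z}"
  shows "colors C = Z"
proof
  have reach: "(y, z) \<in> E'\<^sup>*" if "z \<in> C" for z using assms(1,2) that by (simp add: recurrent_classes_iff)
  show "colors C \<subseteq> Z"
  proof
    fix d assume "d \<in> colors C"
    then obtain z where z: "z \<in> C" "d = col (fst z)" by auto
    from consistent_path[OF reach[OF z(1)] assms(3)] assms(4,5)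
    show "d \<in> Z" using colors_reach(1)[of z Z] z(2) by simp
  qed
  show "Z \<subseteq> colors C"
  proof
    fix d assume "d \<in> Z"
    then obtain z where z: "(y, z) \<in> E'\<^sup>*" "col (fst z) = d" using colors_reach(2)[OF assms(3-5)] by blast
    have "z \<in> C" using assms(1,2) z(1) by (intro closed_rtrancl[of E' C y z]) (simp_all add: recurrent_classes_iff)
    with z(2) show "d \<in> colors C" by auto
  qed
qed

text \<open>A point with bit 1 is reachable from every consistent point, so each recurrent class
  reached contains one, and its colors can be read there. Conversely, once the record is frozen to
  \<open>Z\<close>, every class reached later has colors \<open>Z\<close>.\<close>

theorem colors_Rec_proj:
  assumes "consistent x"
  shows "colors ` Rec G P x = set_at x"
proof
  show "colors ` Rec G P x \<subseteq> set_at x"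
  proof
    fix Z assume "Z \<in> colors ` Rec G P x"
    then obtain C y where C: "C \<in> recurrent_classes G P" "y \<in> C" "(x, y) \<in> E'\<^sup>*" "Z = colors C"
      by (auto simp: Rec_def)
    note y = consistent_path[OF C(3) assms]
    obtain s U m where sUm: "y = (s, vertex U m)" "U \<subseteq> states G" "m \<in> memory \<sigma>" "s \<in> U"
      using y by (cases y) (auto simp: consistent_def)
    then have S: "s \<in> states G" by auto
    then have "Rec G \<sigma> (s, m) \<noteq> {}" using sUm(3) by (intro Rec_nonempty[OF pomdp fin_mem]) simp
    then obtain Z' where Z': "Z' \<in> set_at y" using sUm(1) set_at_vertex[OF S, of U m] by auto
    then obtain z where z: "(y, z) \<in> E'\<^sup>*" "bool_at z = 1" "set_at z = {Z'}" using reach_bool_at[OF conjunct1[OF y] Z'] by blast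
    have "z \<in> C" using C z(1) by (intro closed_rtrancl[of E' C y z]) (simp_all add: recurrent_classes_iff)
    have "consistent z" "set_at z \<subseteq> set_at y" using consistent_path[OF z(1)] y by auto
    with colors_recurrent_proj[OF C(1) \<open>z \<in> C\<close> _ z(2,3)] have "Z = Z'" "Z' \<in> set_at y" using C(4) z(3) by auto
    then show "Z \<in> set_at x" using y by auto
  qed
  show "set_at x \<subseteq> colors ` Rec G P x"
  proof
    fix Z assume Z: "Z \<in> set_at x"
    obtain y where y: "(x, y) \<in> E'\<^sup>*" "bool_at y = 1" "set_at y = {Z}"
      using reach_bool_at[OF assms Z] by blast
    have cy: "consistent y" using consistent_path[OF y(1) assms] by simp
    then have "Rec G P y \<noteq> {}"
      by (intro Rec_nonempty[OF pomdp finite_memory_proj] consistent_states)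
    then obtain C z where C: "C \<in> recurrent_classes G P" "z \<in> C" "(y, z) \<in> E'\<^sup>*" by (auto simp: Rec_def)
    have "colors C = Z"
      using consistent_path[OF C(3) cy] y colors_recurrent_proj[OF C(1,2)] by simp
    moreover have "C \<in> Rec G P x" using C y(1) by (auto simp: Rec_def intro: rtrancl_trans)
    ultimately show "Z \<in> colors ` Rec G P x" by blast
  qed
qed

lemma colors_Rec_proj_start:
  "colors ` Rec G P (start G, minit P) = colors ` Rec G \<sigma> x0"
proof -
  have S: "start G \<in> states G" "minit \<sigma> \<in> memory \<sigma>"
    using pomdp fin_mem by (auto simp: is_pomdp_def finite_memory_def)
  then have "consistent (start G, minit P)" by (auto simp: consistent_def proj_strategy_def)
  from colors_Rec_proj[OF this] show ?thesis using set_at_vertex[OF S(1)] by (simp add: proj_strategy_def)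
qed

theorem proj_winning:
  "almost_sure_winning G P (muller G col \<F>) \<longleftrightarrow> almost_sure_winning G \<sigma> (muller G col \<F>)"
  "positive_winning G P (muller G col \<F>) \<longleftrightarrow> positive_winning G \<sigma> (muller G col \<F>)"
proof -
  interpret proj: strategy_chain G P by (intro strategy_chain.intro pomdp finite_memory_proj)
  have all: "(\<forall>C\<in>R. colors C \<in> \<F>) \<longleftrightarrow> colors ` R \<subseteq> \<F>" and ex: "(\<exists>C\<in>R. colors C \<in> \<F>) \<longleftrightarrow> colors ` R \<inter> \<F> \<noteq> {}"
    for R :: "('s \<times> 'n) set set" by auto
  show "almost_sure_winning G P (muller G col \<F>) \<longleftrightarrow> almost_sure_winning G \<sigma> (muller G col \<F>)"
    unfolding almost_sure_winning_iff proj.almost_sure_winning_iff all colors_Rec_proj_start ..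
  show "positive_winning G P (muller G col \<F>) \<longleftrightarrow> positive_winning G \<sigma> (muller G col \<F>)"
    unfolding positive_winning_iff proj.positive_winning_iff ex colors_Rec_proj_start ..
qed

end

section \<open>Exponential memory\<close>

text \<open>A random bit stream is observed. At a random moment the POMDP secretly stores the bit just
  shown, and \<open>n\<close> rounds later the action has to repeat it, on pain of a restart. The triple \<open>(j, b, e)\<close> is
  the state showing \<open>e\<close>; for \<open>j \<le> n\<close> the stored bit \<open>b\<close> is due in \<open>j\<close> rounds, for \<open>j = n + 1\<close>
  nothing is stored (and \<open>b\<close> is the dummy \<open>2\<close>). The initial state shows \<open>2\<close>.\<close>

definition recall_states :: "nat \<Rightarrow> (nat \<times> nat \<times> nat) set" where
  "recall_states n = {Suc n} \<times> {2} \<times> {..2} \<union> {..n} \<times> {..1} \<times> {..1}"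

text \<open>The last branch covers a correct answer and the phase with nothing stored alike: stay
  without a stored bit, or store the bit shown, as in \<open>(n, 0, 0)\<close> and
  \<open>(n, 1, 1)\<close>. Before the bit is due, both bits can be shown whatever is
  stored.\<close>

definition recall_succ :: "nat \<Rightarrow> nat \<times> nat \<times> nat \<Rightarrow> nat \<Rightarrow> (nat \<times> nat \<times> nat) set" where
  "recall_succ n = (\<lambda>(j, b, e) a.
     if j = 0 \<and> a \<noteq> b then {(Suc n, 2, 2)}
     else if 0 < j \<and> j \<le> n then {(j - 1, b, 0), (j - 1, b, 1)}
     else {(Suc n, 2, 0), (Suc n, 2, 1), (n, 0, 0), (n, 1, 1)})"

abbreviation enc :: "nat \<times> nat \<times> nat \<Rightarrow> nat" where "enc \<equiv> to_nat"

text \<open>States are encoded as numbers to match \<open>nat_winning\<close>. Only the start shows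
  2, which makes its observation class a singleton; as an action, 2 lets every symbol of a window be
  played.\<close>

definition recall :: "nat \<Rightarrow> (nat, nat, nat) pomdp" where
  "recall n = \<lparr>
     states = enc ` recall_states n,
     actions = {..2},
     trans = (\<lambda>s a. map_pmf enc (pmf_of_set (recall_succ n (from_nat s) a))),
     observations = {..2},
     obs = (\<lambda>s. snd (snd (from_nat s :: nat \<times> nat \<times> nat))),
     start = enc (Suc n, 2, 2)\<rparr>"

definition restart_col :: "nat \<Rightarrow> nat \<Rightarrow> nat" where
  "restart_col n s = (if s = start (recall n) then 1 else 0)"

lemma recall_simps [simp]:
  "states (recall n) = enc ` recall_states n" "actions (recall n) = {..2}"
  "observations (recall n) = {..2}" "obs (recall n) (enc x) = snd (snd x)"
  "start (recall n) = enc (Suc n, 2, 2)"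
  by (simp_all add: recall_def)

lemma enc_eq_iff [simp]: "enc x = enc y \<longleftrightarrow> x = y"
  by (simp add: inj_eq)

lemma set_trans_recall [simp]: "set_pmf (trans (recall n) (enc x) a) = enc ` recall_succ n x a"
proof -
  have "finite (recall_succ n x a)" "recall_succ n x a \<noteq> {}"
    by (auto simp: recall_succ_def split: prod.splits)
  then show ?thesis by (simp add: recall_def)
qed

lemma recall_succ_states: "x \<in> recall_states n \<Longrightarrow> recall_succ n x a \<subseteq> recall_states n"
  by (auto simp: recall_states_def recall_succ_def split: if_splits)

lemma is_pomdp_recall: "is_pomdp (recall n)"
proof -
  have "obs_class (recall n) (obs (recall n) (start (recall n))) = {start (recall n)}"
    by (auto simp: obs_class_def recall_states_def)
  then have "card (obs_class (recall n) (obs (recall n) (start (recall n)))) = 1" by simp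
  moreover have "finite (states (recall n))" by (simp add: recall_states_def)
  moreover have "obs (recall n) ` states (recall n) \<subseteq> observations (recall n)"
    by (auto simp: recall_states_def)
  moreover have "start (recall n) \<in> states (recall n)" by (simp add: recall_states_def image_iff)
  moreover have "\<forall>s\<in>states (recall n). \<forall>a\<in>actions (recall n). set_pmf (trans (recall n) s a) \<subseteq> states (recall n)"
    by (simp add: image_mono recall_succ_states)
  ultimately show ?thesis by (simp add: is_pomdp_def)
qed

lemma card_recall: "card (states (recall n)) \<le> 4 * n + 7"
proof -
  have "card (states (recall n)) \<le> card (recall_states n)"
    by (simp add: card_image_le recall_states_def)
  also have "\<dots> \<le> card ({Suc n} \<times> {2::nat} \<times> {..2::nat}) + card ({..n} \<times> {..1::nat} \<times> {..1::nat})"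
    unfolding recall_states_def by (rule card_Un_le)
  also have "\<dots> = 4 * n + 7" by (simp add: card_cartesian_product)
  finally show ?thesis .
qed

lemma recall_chain_graph_iff:
  "((enc x, m), (enc y, m')) \<in> chain_graph (recall n) \<sigma> \<longleftrightarrow>
    x \<in> recall_states n \<and> m \<in> memory \<sigma> \<and> y \<in> recall_states n \<and> m' \<in> memory \<sigma> \<and>
    (\<exists>a\<le>2. a \<in> set_pmf (select \<sigma> m) \<and> y \<in> recall_succ n x a \<and>
       m' \<in> set_pmf (update \<sigma> m (snd (snd y)) a))"
  by (auto simp: chain_graph_iff[OF is_pomdp_recall] inj_image_mem_iff)

text \<open>The latest \<open>Suc n\<close> observations, oldest in front, padded with zeros. The
  head was shown \<open>n\<close> rounds ago, so it is the bit to repeat when the counter reaches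
  0.\<close>

definition window_strategy :: "nat \<Rightarrow> (nat, nat, nat) strategy" where
  "window_strategy n = \<lparr>
     memory = to_nat ` {xs :: nat list. set xs \<subseteq> {..2} \<and> length xs = Suc n},
     minit = to_nat (replicate (Suc n) (0::nat)),
     select = (\<lambda>m. return_pmf (hd (from_nat m))),
     update = (\<lambda>m ob a. return_pmf (to_nat (tl (from_nat m) @ [ob])))\<rparr>"

section \<open>Almost sure winning by a sliding window\<close>

lemma finite_memory_window: "finite_memory (recall n) (window_strategy n)"
proof -
  let ?L = "{xs :: nat list. set xs \<subseteq> {..2} \<and> length xs = Suc n}"
  have "finite ?L"
    by (rule finite_lists_length_eq) simp
  moreover have "tl xs @ [ob] \<in> ?L" if "xs \<in> ?L" "ob \<le> 2" for xs ob
    using that by (cases xs) auto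
  moreover have "hd xs \<le> 2" if "xs \<in> ?L" for xs
    using that by (cases xs) auto
  moreover have "replicate (Suc n) 0 \<in> ?L" by auto
  ultimately show ?thesis
    unfolding finite_memory_def window_strategy_def
    by (auto simp del: replicate_Suc mem_Collect_eq)
qed

text \<open>The invariant of the window strategy: counter and window position of the stored bit
  decrease together.\<close>

definition remembered :: "nat \<Rightarrow> (nat \<times> nat) set" where
  "remembered n = {(enc (j, b, e), to_nat xs) | j b e (xs :: nat list).
     length xs = Suc n \<and> (j \<le> n \<longrightarrow> xs ! j = b)}"

lemma remembered_edge:
  assumes "x \<in> remembered n" "(x, y) \<in> chain_graph (recall n) (window_strategy n)"
  shows "y \<in> remembered n" "fst y \<noteq> start (recall n)"
proof -
  obtain j b e and xs :: "nat list" where x: "x = (enc (j, b, e), to_nat xs)" "length xs = Suc n" "j \<le> n \<longrightarrow> xs ! j = b"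
    using assms(1) by (auto simp: remembered_def)
  obtain s m' where y: "y = (s, m')" by (cases y)
  have "s \<in> states (recall n)" using assms(2) unfolding y by (cases x) (simp add: chain_graph_def del: recall_simps(1))
  then obtain j' b' e' where s: "s = enc (j', b', e')" by auto
  have hd: "hd xs = xs ! 0" using x(2) by (cases xs) auto
  from assms(2) have succ: "(j', b', e') \<in> recall_succ n (j, b, e) (xs ! 0)" "m' = to_nat (tl xs @ [e'])"
    unfolding x(1) y s recall_chain_graph_iff by (auto simp: window_strategy_def hd)
  have nth: "(tl xs @ [e']) ! i = (if i < n then xs ! Suc i else e')" if "i \<le> n" for i
    using x(2) that by (auto simp: nth_append nth_tl)
  have "(j' \<le> n \<longrightarrow> (tl xs @ [e']) ! j' = b') \<and> (j', b', e') \<noteq> (Suc n, 2, 2)"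
    using succ(1) x(3) nth[of j'] by (auto simp: recall_succ_def split: if_splits)
  then show "y \<in> remembered n" "fst y \<noteq> start (recall n)"
    unfolding y s succ(2) using x(2) by (auto simp: remembered_def simp del: append_Cons)
qed

lemma window_almost_sure: "almost_sure_winning (recall n) (window_strategy n) (muller (recall n) (restart_col n) {{0}})"
proof -
  interpret strategy_chain "recall n" "window_strategy n"
    by (intro strategy_chain.intro is_pomdp_recall finite_memory_window)
  have start: "x0 \<in> remembered n"
    by (auto simp: remembered_def window_strategy_def nth_append intro!: exI[of _ "replicate (Suc n) 0"] simp del: replicate_Suc)
  have closed: "E `` remembered n \<subseteq> remembered n" using remembered_edge by blast
  \<comment> \<open>The start satisfies the invariant vacuously, so it is excluded here. Every edge
    from a remembered configuration enters the closed set \<open>?A\<close>, so reachable recurrent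
    configurations lie in it.\<close>
  let ?A = "{x \<in> remembered n. fst x \<noteq> start (recall n)}"
  have closed': "E `` ?A \<subseteq> ?A" using remembered_edge by blast
  show ?thesis unfolding almost_sure_winning_iff
  proof
    fix C assume "C \<in> Rec (recall n) (window_strategy n) x0"
    then obtain z where C: "C \<in> recurrent_classes (recall n) (window_strategy n)" "z \<in> C" "(x0, z) \<in> E\<^sup>*"
      by (auto simp: Rec_def)
    have "fst x \<noteq> start (recall n)" if xC: "x \<in> C" for x
    proof -
      have "(z, x) \<in> E\<^sup>*" using C(1,2) xC by (simp add: recurrent_classes_iff)
      with C(3) have "(x0, x) \<in> E\<^sup>*" by simp
      with closed start have x: "x \<in> remembered n" by (rule closed_rtrancl)
      obtain y where y: "(x, y) \<in> E" using recurrent_class_ex_succ[OF C(1) xC] by blast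
      have "y \<in> ?A" using remembered_edge[OF x y] by simp
      from recurrent_class_avoid[OF C(1) xC closed' y this] show ?thesis by simp
    qed
    then have "restart_col n ` fst ` C = (\<lambda>_. 0) ` C"
      by (auto simp: restart_col_def image_image intro!: image_cong)
    then show "restart_col n ` fst ` C \<in> {{0}}" using C(2) by auto
  qed
qed

text \<open>The strategy cannot know when a bit was stored. Inside a class without restarts, each
  word of \<open>Suc n\<close> bits leads to a memory that is compatible with storage at any of the
  latest \<open>Suc n\<close> moments. This memory must allow recalling every bit of the word, so
  different words need different memories.\<close>

lemma recall_lower_bound:
  assumes fm: "finite_memory (recall n) \<sigma>"
    and pos: "positive_winning (recall n) \<sigma> (muller (recall n) (restart_col n) {{0}})"
  shows "2 ^ Suc n \<le> card (memory \<sigma>)"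
proof -
  interpret strategy_chain "recall n" \<sigma>
    by (intro strategy_chain.intro is_pomdp_recall fm)
  obtain C where C: "C \<in> Rec (recall n) \<sigma> x0" "restart_col n ` fst ` C = {0}"
    using pos unfolding positive_winning_iff by auto
  then have rec: "C \<in> recurrent_classes (recall n) \<sigma>" by (simp add: Rec_def)
  have carrier: "C \<subseteq> states (recall n) \<times> memory \<sigma>" using rec unfolding recurrent_classes_iff by blast
  have no_restart: "(enc (Suc n, 2, 2), m) \<notin> C" for m
  proof
    assume "(enc (Suc n, 2, 2), m) \<in> C"
    then have "restart_col n (enc (Suc n, 2, 2)) \<in> restart_col n ` fst ` C" by force
    then show False unfolding C(2) by (simp add: restart_col_def)
  qed
  have step: "(enc y, m') \<in> C"
    if "(enc x, m) \<in> C" "a \<in> set_pmf (select \<sigma> m)" "y \<in> recall_succ n x a"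
      "m' \<in> set_pmf (update \<sigma> m (snd (snd y)) a)" for x y m m' a
  proof -
    have xm: "x \<in> recall_states n" "m \<in> memory \<sigma>" using that(1) carrier by auto
    have y: "y \<in> recall_states n" using recall_succ_states xm(1) that(3) by blast
    then have "snd (snd y) \<le> 2" by (auto simp: recall_states_def)
    moreover have a: "a \<le> 2" using that(2) xm(2) fm by (auto simp: finite_memory_def)
    ultimately have "m' \<in> memory \<sigma>" using that(4) xm(2) fm by (fastforce simp: finite_memory_def)
    with xm y a that have "((enc x, m), (enc y, m')) \<in> E" unfolding recall_chain_graph_iff by blast
    with that(1) show ?thesis
      using rec by (intro closed_rtrancl[of E C "(enc x, m)" "(enc y, m')"]) (simp_all add: recurrent_classes_iff)
  qed
  have ex_upd: "\<exists>m'. m' \<in> set_pmf (update \<sigma> m ob a)" for m ob a using set_pmf_not_empty by fastforce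
  have ex_sel: "\<exists>a. a \<in> set_pmf (select \<sigma> m)" for m using set_pmf_not_empty by fastforce
  have check: "a = b" if "(enc (0, b, e), m) \<in> C" "a \<in> set_pmf (select \<sigma> m)" for a b e m
  proof (rule ccontr)
    assume "a \<noteq> b"
    then have "(Suc n, 2, 2) \<in> recall_succ n (0, b, e) a" by (simp add: recall_succ_def)
    with step[OF that] ex_upd no_restart show False by fastforce
  qed
  \<comment> \<open>The counter runs down while 0 is shown, and the answer at counter 0 is right by
    \<open>check\<close>.\<close>
  have reset: "\<exists>e m. (enc (Suc n, 2, e), m) \<in> C" if "(enc (j, b, e), m) \<in> C" "j \<le> n" for j b e m
    using that
  proof (induction j arbitrary: e m)
    case 0
    obtain a where a: "a \<in> set_pmf (select \<sigma> m)" using ex_sel by blast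
    obtain m' where m': "m' \<in> set_pmf (update \<sigma> m 0 a)" using ex_upd by blast
    have "(Suc n, 2, 0) \<in> recall_succ n (0, b, e) a" using check[OF 0(1) a] by (simp add: recall_succ_def)
    from step[OF 0(1) a this] m' show ?case by auto
  next
    case (Suc j)
    obtain a where a: "a \<in> set_pmf (select \<sigma> m)" using ex_sel by blast
    obtain m' where m': "m' \<in> set_pmf (update \<sigma> m 0 a)" using ex_upd by blast
    have "(j, b, 0) \<in> recall_succ n (Suc j, b, e) a" using Suc.prems by (simp add: recall_succ_def)
    from step[OF Suc.prems(1) a this] m' have "(enc (j, b, 0), m') \<in> C" by simp
    from Suc.IH[OF this] Suc.prems(2) show ?case by simp
  qed
  obtain e0 m0 where u0: "(enc (Suc n, 2, e0), m0) \<in> C"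
  proof -
    obtain s m where sm: "(s, m) \<in> C" using rec by (auto simp: recurrent_classes_iff)
    then obtain j b e where "s = enc (j, b, e)" "(j, b, e) \<in> recall_states n" using carrier by auto
    then show thesis using that reset[of j b e m] sm by (auto simp: recall_states_def)
  qed
  \<comment> \<open>\<open>w\<close> lists the latest bits shown. One memory \<open>m\<close> is
    shared by the state with nothing stored and by all states that stored some bit \<open>i\<close>
    of \<open>w\<close>; such a bit has aged by \<open>length w - 1 - i\<close> rounds.\<close>
  have words: "\<exists>m. (\<exists>e. (enc (Suc n, 2, e), m) \<in> C) \<and>
      (\<forall>i<length w. \<exists>e. (enc (n - (length w - 1 - i), w ! i, e), m) \<in> C)"
    if "set w \<subseteq> {..1}" "length w \<le> Suc n" for w
    using that
  proof (induction w rule: rev_induct)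
    case Nil
    then show ?case using u0 by auto
  next
    case (snoc c w)
    then obtain m e where m: "(enc (Suc n, 2, e), m) \<in> C"
      "\<And>i. i < length w \<Longrightarrow> \<exists>e. (enc (n - (length w - 1 - i), w ! i, e), m) \<in> C" by auto
    obtain a where a: "a \<in> set_pmf (select \<sigma> m)" using ex_sel by blast
    \<comment> \<open>All successors considered below show \<open>c\<close>, so the same update of
      the memory serves all of them.\<close>
    obtain m' where m': "m' \<in> set_pmf (update \<sigma> m c a)" using ex_upd by blast
    have c: "c = 0 \<or> c = 1" using snoc.prems(1) by auto
    have "(enc (Suc n, 2, c), m') \<in> C" "(enc (n, c, c), m') \<in> C"
      using step[OF m(1) a, of "(Suc n, 2, c)" m'] step[OF m(1) a, of "(n, c, c)" m'] m' c
      by (auto simp: recall_succ_def)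
    moreover have "(enc (n - (length w - i), w ! i, c), m') \<in> C" if i: "i < length w" for i
    proof -
      obtain e where e: "(enc (n - (length w - 1 - i), w ! i, e), m) \<in> C" using m(2)[OF i] by blast
      have j: "n - (length w - 1 - i) = Suc (n - (length w - i))" using snoc.prems(2) i by auto
      have "(n - (length w - i), w ! i, c) \<in> recall_succ n (n - (length w - 1 - i), w ! i, e) a"
        unfolding j using j c by (auto simp: recall_succ_def)
      from step[OF e a this] m' show ?thesis by simp
    qed
    ultimately show ?case
      by (intro exI[of _ m']) (auto simp: nth_append less_Suc_eq)
  qed
  \<comment> \<open>Under common memories, actions and observations both counters run down together;
    at 0 a single action must equal both bits.\<close>
  have same: "b = b'" if "(enc (i, b, e), m) \<in> C" "(enc (i, b', e'), m) \<in> C" "i \<le> n" for i b b' e e' m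
    using that
  proof (induction i arbitrary: e e' m)
    case 0
    then show ?case using check ex_sel by metis
  next
    case (Suc i)
    obtain a where a: "a \<in> set_pmf (select \<sigma> m)" using ex_sel by blast
    obtain m' where m': "m' \<in> set_pmf (update \<sigma> m 0 a)" using ex_upd by blast
    have "(i, b, 0) \<in> recall_succ n (Suc i, b, e) a" "(i, b', 0) \<in> recall_succ n (Suc i, b', e') a"
      using Suc.prems(3) by (auto simp: recall_succ_def)
    with step[OF Suc.prems(1) a] step[OF Suc.prems(2) a] m'
    have "(enc (i, b, 0), m') \<in> C" "(enc (i, b', 0), m') \<in> C" by auto
    with Suc.IH Suc.prems(3) show ?case by simp
  qed
  let ?W = "{w :: nat list. set w \<subseteq> {..1} \<and> length w = Suc n}"
  \<comment> \<open>At full length the counter \<open>n - (n - i)\<close> of bit \<open>i\<close> is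
    just \<open>i\<close>.\<close>
  have "\<forall>w\<in>?W. \<exists>m. \<forall>i\<le>n. \<exists>e. (enc (i, w ! i, e), m) \<in> C"
  proof
    fix w :: "nat list" assume "w \<in> ?W"
    then show "\<exists>m. \<forall>i\<le>n. \<exists>e. (enc (i, w ! i, e), m) \<in> C"
      using words[of w] by (auto simp: less_Suc_eq_le)
  qed
  from bchoice[OF this] obtain f where "\<forall>w\<in>?W. \<forall>i\<le>n. \<exists>e. (enc (i, w ! i, e), f w) \<in> C" ..
  then have f: "\<exists>e. (enc (i, w ! i, e), f w) \<in> C" if "w \<in> ?W" "i \<le> n" for w i
    using that by blast
  have "inj_on f ?W"
  proof
    fix w w' assume w: "w \<in> ?W" "w' \<in> ?W" "f w = f w'"
    show "w = w'"
    proof (rule nth_equalityI)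
      fix i assume "i < length w"
      then have "i \<le> n" using w(1) by simp
      with f[OF w(1)] f[OF w(2)] w(3) same show "w ! i = w' ! i" by metis
    qed (use w in simp)
  qed
  moreover have "f ` ?W \<subseteq> memory \<sigma>" using f[of _ 0] carrier by fastforce
  moreover have "finite (memory \<sigma>)" using fm by (simp add: finite_memory_def)
  ultimately have "card ?W \<le> card (memory \<sigma>)" by (rule card_inj_on_le)
  moreover have "card ?W = card {..1::nat} ^ Suc n" by (rule card_lists_length_eq) simp
  ultimately show ?thesis by (simp add: numeral_2_eq_2)
qed

text \<open>The witness wins in the strongest sense and the bound holds in the weakest, so any
  notion in between is covered.\<close>

lemma exponential_memory_required_between:
  assumes "\<And>G \<sigma> \<phi>. almost_sure_winning G \<sigma> \<phi> \<Longrightarrow> win G \<sigma> \<phi>"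
    and "\<And>G \<sigma> \<phi>. win G \<sigma> \<phi> \<Longrightarrow> positive_winning G \<sigma> \<phi>"
  shows "exponential_memory_required win"
  unfolding exponential_memory_required_def
\<comment> \<open>At most \<open>4 * n + 7\<close> states, three actions, three observations and two
  colors.\<close>
proof (intro exI[of _ "15::nat"] allI)
  fix n :: nat
  have col: "is_coloring (recall n) {0, 1} (restart_col n)" by (auto simp: is_coloring_def restart_col_def)
  have card: "card (states (recall n)) + card (actions (recall n)) + card (observations (recall n)) + card {0, 1::nat} \<le> 15 * Suc n"
    using card_recall[of n] by simp
  have low: "2 ^ n \<le> card (memory \<sigma>)"
    if "finite_memory (recall n) \<sigma> \<and> win (recall n) \<sigma> (muller (recall n) (restart_col n) {{0}})" for \<sigma>
  proof -
    have "2 ^ Suc n \<le> card (memory \<sigma>)" using that assms(2) by (intro recall_lower_bound) auto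
    then show ?thesis by simp
  qed
  show "\<exists>G (D :: nat set) col \<F>. is_pomdp G \<and> is_coloring G D col \<and> \<F> \<subseteq> Pow D \<and>
      card (states G) + card (actions G) + card (observations G) + card D \<le> 15 * Suc n \<and>
      (\<exists>\<sigma>. finite_memory G \<sigma> \<and> win G \<sigma> (muller G col \<F>)) \<and>
      (\<forall>\<sigma>. finite_memory G \<sigma> \<and> win G \<sigma> (muller G col \<F>) \<longrightarrow> 2 ^ n \<le> card (memory \<sigma>))"
    by (intro exI[of _ "recall n"] exI[of _ "{0, 1} :: nat set"] exI[of _ "restart_col n"] exI[of _ "{{0}}"] conjI
        exI[of _ "window_strategy n"] is_pomdp_recall col card finite_memory_window
        assms(1)[OF window_almost_sure] allI impI low) auto
qed

section \<open>Beliefs are not enough\<close>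

text \<open>In states \<open>1\<close> and \<open>2\<close> the actions \<open>0\<close> and \<open>1\<close>, respectively, are the right ones, and lead to
  the other of these two states; a wrong action leads to state \<open>3\<close>, from where one restarts randomly.
  Alternating actions synchronise with the state eventually, but from round \<open>1\<close> on the
  belief is always \<open>{1, 2, 3}\<close>.\<close>

definition sync_succ :: "nat \<Rightarrow> nat \<Rightarrow> nat set" where
  "sync_succ s a =
     (if s = 0 then {1, 2, 3} else if s = 3 then {1, 2}
      else if s = 1 then (if a = 0 then {2} else {3}) else (if a = 0 then {3} else {1}))"

definition sync :: "(nat, nat, nat) pomdp" where
  "sync = \<lparr>states = {..3}, actions = {..1}, trans = (\<lambda>s a. pmf_of_set (sync_succ s a)),
     observations = {..1}, obs = (\<lambda>s. if s = 0 then 0 else 1), start = 0\<rparr>"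

definition sync_col :: "nat \<Rightarrow> nat" where
  "sync_col s = (if s = 3 then 1 else 0)"

lemma sync_simps [simp]:
  "states sync = {..3}" "actions sync = {..1}" "observations sync = {..1}"
  "obs sync s = (if s = 0 then 0 else 1)" "start sync = 0"
  by (simp_all add: sync_def)

lemma set_trans_sync [simp]: "set_pmf (trans sync s a) = sync_succ s a"
proof -
  have "finite (sync_succ s a)" "sync_succ s a \<noteq> {}" by (auto simp: sync_succ_def)
  then show ?thesis by (simp add: sync_def)
qed

lemma sync_succ_subset: "sync_succ s a \<subseteq> {1, 2, 3}"
  by (auto simp: sync_succ_def)

lemma is_pomdp_sync: "is_pomdp sync"
proof -
  have "obs_class sync 0 = {0}" by (auto simp: obs_class_def)
  moreover have "sync_succ s a \<subseteq> {..3}" for s a using sync_succ_subset[of s a] by auto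
  ultimately show ?thesis by (auto simp: is_pomdp_def)
qed

section \<open>Plays and beliefs of the synchronisation example\<close>

lemma mem_plays_sync_iff:
  "\<rho> \<in> plays sync \<longleftrightarrow> fst (\<rho> 0) = 0 \<and>
     (\<forall>i. snd (\<rho> i) \<le> 1 \<and> fst (\<rho> (Suc i)) \<in> sync_succ (fst (\<rho> i)) (snd (\<rho> i)))"
  unfolding plays_def by (simp add: pmf_positive_iff)

lemma plays_sync_Suc: "\<rho> \<in> plays sync \<Longrightarrow> fst (\<rho> (Suc i)) \<in> {1, 2, 3}"
  using sync_succ_subset unfolding mem_plays_sync_iff by blast

lemma plays_sync_pos: "\<rho> \<in> plays sync \<Longrightarrow> i > 0 \<Longrightarrow> fst (\<rho> i) \<in> {1, 2, 3}"
  using plays_sync_Suc[of \<rho> "i - 1"] by simp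

text \<open>Built backwards: under either action each of 1, 2, 3 has a predecessor among these
  states. So no action sequence excludes any of them.\<close>

lemma sync_path:
  assumes "t \<in> {1, 2, 3}"
  shows "\<exists>p. p 0 = 0 \<and> p (Suc k) = t \<and> (\<forall>i\<le>k. p (Suc i) \<in> sync_succ (p i) (\<alpha> i))"
  using assms
proof (induction k arbitrary: t)
  case 0
  then show ?case by (intro exI[of _ "\<lambda>i. if i = 0 then 0 else t"]) (auto simp: sync_succ_def)
next
  case (Suc k)
  obtain u where u: "u \<in> {1, 2, 3}" "t \<in> sync_succ u (\<alpha> (Suc k))"
  proof (cases "t = 3")
    case True
    then show thesis using that[of "if \<alpha> (Suc k) = 0 then 2 else 1"] by (auto simp: sync_succ_def)
  next
    case False
    then show thesis using that[of 3] Suc.prems by (auto simp: sync_succ_def)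
  qed
  obtain p where p: "p 0 = 0" "p (Suc k) = u" "\<forall>i\<le>k. p (Suc i) \<in> sync_succ (p i) (\<alpha> i)"
    using Suc.IH[OF u(1)] by blast
  then show ?case using u(2)
    by (intro exI[of _ "p(Suc (Suc k) := t)"]) (auto simp: le_Suc_eq)
qed

lemma sync_play:
  assumes "\<And>i. \<alpha> i \<le> 1" "t \<in> {1, 2, 3}"
  shows "\<exists>\<rho>\<in>plays sync. fst (\<rho> (Suc k)) = t \<and> (\<forall>i\<le>k. snd (\<rho> i) = \<alpha> i)"
proof -
  obtain p where p: "p 0 = 0" "p (Suc k) = t" "\<And>i. i \<le> k \<Longrightarrow> p (Suc i) \<in> sync_succ (p i) (\<alpha> i)"
    using sync_path[OF assms(2)] by blast
  \<comment> \<open>\<open>belief\<close> is defined through infinite plays, so the finite path is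
    prolonged along the cycle 1, 2, 3 under action 0.\<close>
  define nxt :: "nat \<Rightarrow> nat" where "nxt s = (if s = 1 then 2 else if s = 2 then 3 else 1)" for s
  define q where "q i = (if i \<le> Suc k then p i else (nxt ^^ (i - Suc k)) t)" for i
  define \<rho> where "\<rho> i = (q i, if i \<le> k then \<alpha> i else 0)" for i
  have nxt: "nxt s \<in> sync_succ s 0" if "s \<in> {1, 2, 3}" for s
    using that by (auto simp: nxt_def sync_succ_def)
  have iter: "(nxt ^^ j) t \<in> {1, 2, 3}" for j
    by (induction j) (use assms(2) in \<open>auto simp: nxt_def\<close>)
  have "q (Suc i) \<in> sync_succ (q i) (if i \<le> k then \<alpha> i else 0)" for i
  proof (cases "i \<le> k")
    case True
    then show ?thesis using p(3) by (simp add: q_def)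
  next
    case False
    then obtain j where j: "i = Suc k + j" using le_Suc_ex[of "Suc k" i] by auto
    then have "q i = (nxt ^^ j) t" "q (Suc i) = nxt (q i)"
      using p(2) by (auto simp: q_def Suc_diff_le)
    then show ?thesis using False nxt iter by simp
  qed
  then have "\<rho> \<in> plays sync" using assms(1) p(1) by (simp add: mem_plays_sync_iff \<rho>_def) (simp add: q_def)
  moreover have "fst (\<rho> (Suc k)) = t" using p(2) by (simp add: \<rho>_def q_def)
  ultimately show ?thesis by (intro bexI[of _ \<rho>]) (auto simp: \<rho>_def)
qed

lemma belief_sync:
  assumes "\<rho> \<in> plays sync" "k > 0"
  shows "belief sync (obs_action_seq sync \<rho> k) = {1, 2, 3}"
proof
  obtain l where k: "k = Suc l" using assms(2) by (cases k) auto
  have obs: "obs sync (fst (\<rho>' i)) = (if i = 0 then 0 else 1)" if "\<rho>' \<in> plays sync" for \<rho>' i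
    using plays_sync_pos[OF that, of i] that by (cases i) (auto simp: mem_plays_sync_iff)
  show "belief sync (obs_action_seq sync \<rho> k) \<subseteq> {1, 2, 3}"
  proof
    fix s assume "s \<in> belief sync (obs_action_seq sync \<rho> k)"
    then obtain \<rho>' k' where *: "s = fst (\<rho>' k')" "\<rho>' \<in> plays sync" "obs_action_seq sync \<rho>' k' = obs_action_seq sync \<rho> k"
      by (auto simp: belief_def)
    from *(3) have "length (fst (obs_action_seq sync \<rho>' k')) = length (fst (obs_action_seq sync \<rho> k))" by simp
    then have "k' = k" by (simp add: obs_action_seq_def)
    then show "s \<in> {1, 2, 3}" using plays_sync_pos[OF *(2)] assms(2) *(1) by simp
  qed
  show "{1, 2, 3} \<subseteq> belief sync (obs_action_seq sync \<rho> k)"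
  proof
    fix t :: nat assume t: "t \<in> {1, 2, 3}"
    have "snd (\<rho> i) \<le> 1" for i using assms(1) by (simp add: mem_plays_sync_iff)
    from sync_play[of "\<lambda>i. snd (\<rho> i)", OF this t, of l]
    obtain \<rho>' where \<rho>': "\<rho>' \<in> plays sync" "fst (\<rho>' k) = t" "\<And>i. i \<le> l \<Longrightarrow> snd (\<rho>' i) = snd (\<rho> i)"
      unfolding k by auto
    have "obs_action_seq sync \<rho>' k = obs_action_seq sync \<rho> k"
      unfolding obs_action_seq_def obs[OF \<rho>'(1)] obs[OF assms(1)] using \<rho>'(3) k by (auto simp: less_Suc_eq_le)
    with \<rho>'(1,2) show "t \<in> belief sync (obs_action_seq sync \<rho> k)"
      unfolding belief_def by (intro CollectI exI[of _ \<rho>'] exI[of _ k]) simp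
  qed
qed

definition alternating :: "(nat, nat, nat) strategy" where
  "alternating = \<lparr>memory = {..1}, minit = 0, select = return_pmf, update = (\<lambda>m ob a. return_pmf (1 - m))\<rparr>"

lemma finite_memory_alternating: "finite_memory sync alternating"
  by (auto simp: finite_memory_def alternating_def)

lemma alternating_edge_iff:
  "((s, m), (s', m')) \<in> chain_graph sync alternating \<longleftrightarrow>
     s \<le> 3 \<and> m \<le> 1 \<and> s' \<in> sync_succ s m \<and> m' = 1 - m"
  using sync_succ_subset[of s m] by (auto simp: chain_graph_iff[OF is_pomdp_sync] alternating_def)

text \<open>From state 3 one of the two random successors matches the memory, and matched pairs,
  collected in \<open>?A\<close>, stay matched. So state 3 cannot be recurrent.\<close>

lemma alternating_almost_sure: "almost_sure_winning sync alternating (muller sync sync_col {{0}})"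
proof -
  interpret strategy_chain sync alternating
    by (intro strategy_chain.intro is_pomdp_sync finite_memory_alternating)
  let ?A = "{(1, 0), (2, 1)} :: (nat \<times> nat) set"
  have closed: "E `` ?A \<subseteq> ?A" by (auto simp: alternating_edge_iff sync_succ_def)
  show ?thesis unfolding almost_sure_winning_iff
  proof
    fix C assume "C \<in> Rec sync alternating x0"
    then have C: "C \<in> recurrent_classes sync alternating" by (simp add: Rec_def)
    have "fst x \<noteq> 3" if "x \<in> C" for x
    proof
      assume "fst x = 3"
      then obtain m where x: "x = (3, m)" by (cases x) auto
      have "x \<in> states sync \<times> memory alternating" using C that unfolding recurrent_classes_iff by blast
      then have m: "m \<le> 1" using x by (simp add: alternating_def)
      then have "(x, (if m = 0 then 2 else 1, 1 - m)) \<in> E"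
        unfolding x alternating_edge_iff by (auto simp: sync_succ_def)
      from recurrent_class_avoid[OF C that closed this] m show False unfolding x by (cases "m = 0") auto
    qed
    then have "sync_col ` fst ` C = (\<lambda>_. 0) ` C"
      by (auto simp: sync_col_def image_image intro!: image_cong)
    then show "sync_col ` fst ` C \<in> {{0}}" using C by (auto simp: recurrent_classes_iff)
  qed
qed

text \<open>Throughout \<open>C\<close>, apart from the start state, one and the same action
  \<open>a\<close> is possible. Repeating it leads from 1 and from 2 to state 3 within two
  steps.\<close>

lemma belief_based_not_positive:
  assumes fm: "finite_memory sync \<sigma>" and bb: "belief_based_stationary sync \<sigma>"
  shows "\<not> positive_winning sync \<sigma> (muller sync sync_col {{0}})"
proof
  interpret strategy_chain sync \<sigma> by (intro strategy_chain.intro is_pomdp_sync fm)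
  assume "positive_winning sync \<sigma> (muller sync sync_col {{0}})"
  then obtain C where C: "C \<in> Rec sync \<sigma> x0" "sync_col ` fst ` C = {0}"
    unfolding positive_winning_iff by auto
  then obtain z where rec: "C \<in> recurrent_classes sync \<sigma>" and z: "z \<in> C" "(x0, z) \<in> E\<^sup>*" by (auto simp: Rec_def)
  have carrier: "C \<subseteq> states sync \<times> memory \<sigma>" using rec unfolding recurrent_classes_iff by blast
  have not3: "(3, m) \<notin> C" for m
  proof
    assume "(3, m) \<in> C"
    then have "sync_col 3 \<in> sync_col ` fst ` C" by force
    then show False unfolding C(2) by (simp add: sync_col_def)
  qed
  obtain f where f: "\<And>\<omega> k. \<omega> \<in> runs sync \<sigma> \<Longrightarrow>
      select \<sigma> (fst (snd (\<omega> k))) = f (belief sync (obs_action_seq sync (play_of \<omega>) k))"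
    using bb unfolding belief_based_stationary_def play_of_def by blast
  \<comment> \<open>The condition on \<open>f\<close> speaks about runs, so the configuration is
    visited by one; this happens after round 0 because \<open>s\<close> is not the start, hence at
    the full belief.\<close>
  have sel: "select \<sigma> m = f {1, 2, 3}" if "(s, m) \<in> C" "s \<noteq> 0" for s m
  proof -
    have "(z, (s, m)) \<in> E\<^sup>*" using rec z(1) that(1) by (simp add: recurrent_classes_iff)
    with z(2) have "(x0, (s, m)) \<in> E\<^sup>*" by simp
    from ex_run_visiting[OF this, of "\<lambda>_. True"] obtain \<omega> k where \<omega>: "typical \<omega>" "config (\<omega> k) = (s, m)" by auto
    note run = typical_runs[OF \<omega>(1)]
    have "k \<noteq> 0" using runs_config_0[OF run] \<omega>(2) that(2) by (intro notI) simp
    then have "belief sync (obs_action_seq sync (play_of \<omega>) k) = {1, 2, 3}"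
      by (intro belief_sync runs_plays[OF run]) simp
    then show ?thesis using f[OF run, of k] \<omega>(2) by (cases "\<omega> k") (simp add: config_def)
  qed
  obtain a where a: "a \<in> set_pmf (f {1, 2, 3})" using set_pmf_not_empty by fastforce
  have step: "\<exists>m'. (s', m') \<in> C" if "(s, m) \<in> C" "s \<noteq> 0" "s' \<in> sync_succ s a" for s m s'
  proof -
    have sm: "s \<le> 3" "m \<in> memory \<sigma>" using that(1) carrier by auto
    have am: "a \<in> set_pmf (select \<sigma> m)" using a sel[OF that(1,2)] by simp
    then have aA: "a \<in> actions sync" using sm fm unfolding finite_memory_def by blast
    have s': "s' \<in> {1, 2, 3}" using that(3) sync_succ_subset by blast
    obtain m' where m': "m' \<in> set_pmf (update \<sigma> m (obs sync s') a)" using set_pmf_not_empty by fastforce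
    have "obs sync s' \<in> observations sync" by simp
    then have "m' \<in> memory \<sigma>" using m' sm(2) aA fm unfolding finite_memory_def by blast
    then have "((s, m), (s', m')) \<in> E"
      unfolding chain_graph_iff[OF is_pomdp_sync] using sm s' aA am m' that(3) by auto
    then have "(s', m') \<in> C" using that(1) rec
      by (intro closed_rtrancl[of E C "(s, m)" "(s', m')"]) (simp_all add: recurrent_classes_iff)
    then show ?thesis by blast
  qed
  \<comment> \<open>\<open>z\<close> is not yet known to differ from the start, where the belief is
    another one; its successor lies in states 1, 2, 3.\<close>
  obtain y where y: "y \<in> C" "(z, y) \<in> E" using recurrent_class_ex_succ[OF rec z(1)] by blast
  obtain s m where sm: "y = (s, m)" by (cases y)
  have "s \<in> {1, 2, 3}"
    using y(2) sync_succ_subset unfolding sm by (cases z) (force simp: chain_graph_iff[OF is_pomdp_sync])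
  then have "s = 1 \<or> s = 2" using y(1) not3 unfolding sm by auto
  then have "\<exists>m. (3, m) \<in> C"
  proof
    assume s: "s = 1"
    show ?thesis
    proof (cases "a = 0")
      case True
      then obtain m' where "(2, m') \<in> C" using step[of s m 2] y(1) s sm by (auto simp: sync_succ_def)
      then show ?thesis using step[of 2 m' 3] True by (auto simp: sync_succ_def)
    next
      case False
      then show ?thesis using step[of s m 3] y(1) s sm by (auto simp: sync_succ_def)
    qed
  next
    assume s: "s = 2"
    show ?thesis
    proof (cases "a = 0")
      case True
      then show ?thesis using step[of s m 3] y(1) s sm by (auto simp: sync_succ_def)
    next
      case False
      then obtain m' where "(1, m') \<in> C" using step[of s m 1] y(1) s sm by (auto simp: sync_succ_def)
      then show ?thesis using step[of 1 m' 3] False by (auto simp: sync_succ_def)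
    qed
  qed
  then show False using not3 by blast
qed

lemma belief_based_insufficient_between:
  assumes "\<And>G \<sigma> \<phi>. almost_sure_winning G \<sigma> \<phi> \<Longrightarrow> win G \<sigma> \<phi>"
    and "\<And>G \<sigma> \<phi>. win G \<sigma> \<phi> \<Longrightarrow> positive_winning G \<sigma> \<phi>"
  shows "belief_based_insufficient win"
  unfolding belief_based_insufficient_def
proof (intro exI[of _ sync] exI[of _ "{0, 1} :: nat set"] exI[of _ sync_col] exI[of _ "{{0}}"] conjI)
  show "is_coloring sync {0, 1} sync_col" by (auto simp: is_coloring_def sync_col_def)
  show "\<exists>\<sigma>. finite_memory sync \<sigma> \<and> win sync \<sigma> (muller sync sync_col {{0}})"
    using finite_memory_alternating assms(1)[OF alternating_almost_sure] by blast
  show "\<not> (\<exists>\<sigma>. finite_memory sync \<sigma> \<and> belief_based_stationary sync \<sigma> \<and>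
      win sync \<sigma> (muller sync sync_col {{0}}))"
    using belief_based_not_positive assms(2) by blast
qed (auto intro: is_pomdp_sync)

theorem theorem2:
  shows "(\<forall>(G :: ('s, 'a, 'o) pomdp) (D :: 'd set) col \<F> (\<sigma> :: ('m, 'o, 'a) strategy).
            is_pomdp G \<and> is_coloring G D col \<and> \<F> \<subseteq> Pow D \<and> finite_memory G \<sigma> \<longrightarrow>
              (almost_sure_winning G \<sigma> (muller G col \<F>) \<longrightarrow>
                 finite_memory G (proj_strategy G col \<sigma>) \<and>
                 card (memory (proj_strategy G col \<sigma>)) \<le> mem_bound G D \<and>
                 almost_sure_winning G (proj_strategy G col \<sigma>) (muller G col \<F>)) \<and>
              (positive_winning G \<sigma> (muller G col \<F>) \<longrightarrow>
                 finite_memory G (proj_strategy G col \<sigma>) \<and>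
                 card (memory (proj_strategy G col \<sigma>)) \<le> mem_bound G D \<and>
                 positive_winning G (proj_strategy G col \<sigma>) (muller G col \<F>)))
       \<and> exponential_memory_required almost_sure_winning
       \<and> exponential_memory_required positive_winning
       \<and> belief_based_insufficient almost_sure_winning
       \<and> belief_based_insufficient positive_winning"
proof (intro conjI allI impI)
  fix G :: "('s, 'a, 'o) pomdp" and D :: "'d set" and col \<F> and \<sigma> :: "('m, 'o, 'a) strategy"
  assume *: "is_pomdp G \<and> is_coloring G D col \<and> \<F> \<subseteq> Pow D \<and> finite_memory G \<sigma>"
  then interpret projection G \<sigma> col by (intro projection.intro strategy_chain.intro) auto
  show "finite_memory G P" "finite_memory G P" by (rule finite_memory_proj)+
  show "card (memory P) \<le> mem_bound G D" "card (memory P) \<le> mem_bound G D"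
    using * card_proj_vertices by (simp_all add: proj_strategy_def)
  show "almost_sure_winning G P (muller G col \<F>)" if "almost_sure_winning G \<sigma> (muller G col \<F>)"
    using that proj_winning(1) by blast
  show "positive_winning G P (muller G col \<F>)" if "positive_winning G \<sigma> (muller G col \<F>)"
    using that proj_winning(2) by blast
qed (rule exponential_memory_required_between belief_based_insufficient_between;
    simp add: almost_sure_imp_positive)+

end
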